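(* Let $\phi$ be a Ma-Minda function such that $\min_{|z|=r}|\phi(z)|=\phi(-r)$ and $\max_{|z|=r}|\phi(z)|=\phi(r)$ for all $0<r<1$. Let $k$ be the analytic function in $\mathbb{D}$ with $1+zk''(z)/k'(z)=\phi(z)$, $k(0)=k'(0)-1=0$, and put $$T(r):=\int_0^r\frac1s\int_0^sM_{k'}(t)M_\phi(t)\,dt\,ds ,$$ where $M_{k'}$ and $M_\phi$ are the majorant series of $k'$ and $\phi$. Let $f(z)=z+\sum_{n=2}^\infty a_nz^n\in\mathcal{C}_c(\phi)$. Then $$|z|+\sum_{n=2}^\infty|a_n||z|^n\le d(f(0),\partial f(\mathbb{D}))$$ for $|z|=r\le\min\{1/3,r_f\}$, where $r_f$ is the smallest positive root of $T(r)=-k(-1)$ in $(0,1)$.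
   Context: $\mathbb{D}=\{z\in\mathbb{C}:|z|<1\}$ and $\mathcal{A}$ is the class of analytic functions $f$ in $\mathbb{D}$ of the form $f(z)=z+\sum_{n\ge2}a_nz^n$. $d$ is Euclidean distance, $d(f(0),\partial f(\mathbb{D}))$ being the distance from $f(0)$ to the boundary of $f(\mathbb{D})$. For $f(z)=\sum_{n\ge0}a_nz^n$ analytic in $\mathbb{D}$, the majorant series is $M_f(r)=\sum_{n\ge0}|a_n|r^n$, $0\le r<1$. For analytic $f,g$ in $\mathbb{D}$, $f\prec g$ means $f=g\circ\omega$ for some analytic $\omega:\mathbb{D}\to\mathbb{D}$ with $\omega(0)=0$. A Ma-Minda function is an analytic univalent function $\phi:\mathbb{D}\to\mathbb{C}$ such that $\phi(\mathbb{D})$ lies in the right half-plane $\{\mathrm{Re}\,w>0\}$, is symmetric with respect to the real axis and starlike with respect to $\phi(0)=1$, and $\phi'(0)>0$. $\mathcal{C}_c(\phi)$ (convex functions with respect to conjugate points associated with $\phi$) is the class of $f\in\mathcal{A}$ with $\dfrac{2(zf'(z))'}{\left(f(z)+\overline{f(\bar z)}\right)'}\prec\phi(z)$ in $\mathbb{D}$. The value $k(-1)$ denotes $\lim_{r\to1^-}k(-r)$. *)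

theory Defs
  imports "HOL-Complex_Analysis.Complex_Analysis"
begin

abbreviation unit_disc :: "complex set" where
  "unit_disc \<equiv> ball 0 1"

definition class_A :: "(complex \<Rightarrow> complex) set" where
  "class_A = {f. f holomorphic_on unit_disc \<and> f 0 = 0 \<and> deriv f 0 = 1}"

definition majorant :: "(complex \<Rightarrow> complex) \<Rightarrow> real \<Rightarrow> real" where
  "majorant f r = (\<Sum>n. norm (fps_nth (fps_expansion f 0) n) * r ^ n)"

definition subordinate :: "(complex \<Rightarrow> complex) \<Rightarrow> (complex \<Rightarrow> complex) \<Rightarrow> bool" where
  "subordinate f g \<longleftrightarrow>
     (\<exists>\<omega>. \<omega> holomorphic_on unit_disc \<and> \<omega> ` unit_disc \<subseteq> unit_disc \<and> \<omega> 0 = 0 \<and>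
          (\<forall>z\<in>unit_disc. f z = g (\<omega> z)))"

definition starlike_wrt :: "complex \<Rightarrow> complex set \<Rightarrow> bool" where
  "starlike_wrt a S \<longleftrightarrow> a \<in> S \<and> (\<forall>w\<in>S. closed_segment a w \<subseteq> S)"

definition ma_minda :: "(complex \<Rightarrow> complex) \<Rightarrow> bool" where
  "ma_minda \<phi> \<longleftrightarrow>
     \<phi> holomorphic_on unit_disc \<and> inj_on \<phi> unit_disc \<and>
     \<phi> ` unit_disc \<subseteq> {w. Re w > 0} \<and>
     cnj ` (\<phi> ` unit_disc) = \<phi> ` unit_disc \<and>
     \<phi> 0 = 1 \<and> starlike_wrt 1 (\<phi> ` unit_disc) \<and>
     deriv \<phi> 0 \<in> \<real> \<and> Re (deriv \<phi> 0) > 0"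

(* Division by zero is harmless here: where the denominator vanishes the quotient
   is 0 in HOL, which is not a value of a Ma-Minda function. *)
definition convex_conj_class :: "(complex \<Rightarrow> complex) \<Rightarrow> (complex \<Rightarrow> complex) set" where
  "convex_conj_class \<phi> = {f \<in> class_A.
     subordinate
       (\<lambda>z. 2 * deriv (\<lambda>w. w * deriv f w) z / deriv (\<lambda>w. f w + cnj (f (cnj w))) z) \<phi>}"

(* At s = 0 the outer integrand takes the HOL value of 1/0; a single point does not
   affect the integral. *)
definition T_fun :: "(complex \<Rightarrow> complex) \<Rightarrow> (complex \<Rightarrow> complex) \<Rightarrow> real \<Rightarrow> real" where
  "T_fun k \<phi> r =
     integral {0..r} (\<lambda>s. 1 / s * integral {0..s} (\<lambda>t. majorant (deriv k) t * majorant \<phi> t))"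

(* The boundary value written k(-1): the radial limit of k along the negative real axis. *)
definition value_at_minus_one :: "(complex \<Rightarrow> complex) \<Rightarrow> complex" where
  "value_at_minus_one k = Lim (at_left (1::real)) (\<lambda>r. k (- complex_of_real r))"

definition smallest_root_T :: "(complex \<Rightarrow> complex) \<Rightarrow> (complex \<Rightarrow> complex) \<Rightarrow> real \<Rightarrow> bool" where
  "smallest_root_T k \<phi> r \<longleftrightarrow>
     0 < r \<and> r < 1 \<and> complex_of_real (T_fun k \<phi> r) = - value_at_minus_one k \<and>
     (\<forall>s. 0 < s \<and> s < r \<longrightarrow> complex_of_real (T_fun k \<phi> s) \<noteq> - value_at_minus_one k)"

end

theory Submission
  imports Defs
begin

text \<open>
  Let \<open>F = z f'\<close> and let \<open>g\<close> be the mean of \<open>f\<close> and its reflection \<open>cnj (f (cnj z))\<close>. Membership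
  of \<open>f\<close> in the class says \<open>F' = g' (\<phi> \<circ> \<omega>)\<close> with a Schwarz function \<open>\<omega>\<close>. Adding the reflected
  equation shows that \<open>1 + z g''/g'\<close> is the mean of \<open>\<phi> \<circ> \<omega>\<close> and its reflection; in particular
  \<open>g\<close> is a convex function.

  The crucial fact is \<open>g' \<prec> k'\<close>. The mean just mentioned need not take its values in \<open>\<phi>(D)\<close>, which
  is only starlike, so the comparison is made one integration later. Write \<open>k' = exp H\<close> with
  \<open>z H' = \<phi> - 1\<close>. Since \<open>\<phi> - 1\<close> is starlike, \<open>H\<close> is convex (Alexander), and the primitive \<open>h\<close> of
  \<open>(\<phi> \<circ> \<omega> - 1)/z\<close> is subordinate to \<open>H\<close> (Suffridge). Now \<open>log g'\<close> is the mean of \<open>h\<close> and its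
  reflection, and \<open>H(D)\<close> is convex and symmetric, so \<open>log g' \<prec> H\<close>.

  Upper estimate. Bohr's phenomenon gives \<open>M\<^sub>u \<le> M\<^sub>v\<close> on \<open>[0, 1/3]\<close> whenever \<open>u \<prec> v\<close>, so there the
  majorant of \<open>(z f')'\<close> is at most the product of the majorants of \<open>k'\<close> and \<open>\<phi>\<close>. The
  double integral defining \<open>T\<close> turns the majorant of \<open>(z f')'\<close> back into that of \<open>f\<close>, hence
  \<open>M\<^sub>f \<le> T\<close>.

  Lower estimate. Subordination gives \<open>|g'(z)| \<ge> k'(-|z|)\<close>, because \<open>Re H\<close> is smallest at \<open>-r\<close> on
  the closed disc of radius \<open>r\<close>. With the minimum modulus hypothesis,
  \<open>|F'(z)| \<ge> k'(-t) \<phi>(-t) = d/dt (t k'(-t))\<close> at \<open>t = |z|\<close>. Both \<open>F\<close> and \<open>f\<close> are close-to-convex,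
  hence univalent, and a lower bound for the derivative of a univalent function integrates along the
  preimage of a radial segment: first \<open>|f'(z)| \<ge> k'(-|z|)\<close>, then \<open>|f(z)| \<ge> -k(-|z|)\<close>. So \<open>f(D)\<close>
  contains the disc of radius \<open>-k(-1)\<close>.

  Finally \<open>T\<close> is continuous and nondecreasing with \<open>T(0) = 0\<close>, and
  \<open>T(r) \<ge> M\<^sub>k(r) \<ge> -k(-r) + \<phi>'(0) r\<^sup>2\<close>, which exceeds \<open>-k(-1)\<close> for \<open>r\<close> near \<open>1\<close>. So the smallest root
  \<open>r\<^sub>f\<close> exists, and for \<open>r \<le> min (1/3) r\<^sub>f\<close> the estimates combine to \<open>M\<^sub>f(r) \<le> T(r) \<le> T(r\<^sub>f) = -k(-1)\<close>,
  which is at most the distance from \<open>f(0)\<close> to the boundary of \<open>f(D)\<close>.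
\<close>

section \<open>Bohr's phenomenon for majorant series\<close>

abbreviation (input) taylor :: "(complex \<Rightarrow> complex) \<Rightarrow> nat \<Rightarrow> complex" where
  "taylor f n \<equiv> fps_nth (fps_expansion f 0) n"

text \<open>
  On a circle the \<open>n\<close>-th Fourier coefficient of \<open>cnj p\<close> vanishes for \<open>n \<ge> 1\<close>, so that of \<open>p\<close> is also
  the one of \<open>2 Re p\<close>, a nonnegative function whose mean is \<open>2 Re (p 0)\<close>.
\<close>
lemma caratheodory_coefficient_bound:
  assumes hol: "p holomorphic_on unit_disc"
    and pos: "\<And>z. z \<in> unit_disc \<Longrightarrow> 0 \<le> Re (p z)"
    and n: "n \<ge> 1"
  shows "norm (taylor p n) \<le> 2 * Re (p 0)"
proof -
  have circ: "r ^ n * norm (taylor p n) \<le> 2 * Re (p 0)" if r: "0 < r" "r < 1" for r :: real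
  proof -
    define q where "q t = p (of_real r * cis t)" for t
    have cont: "continuous_on (cball 0 r) p" and holb: "p holomorphic_on ball 0 r"
      using r by (auto intro!: holomorphic_on_imp_continuous_on holomorphic_on_subset[OF hol])
    have coeff: "((\<lambda>t. q t * cis (- (real m * t))) has_integral (2 * pi * r ^ m * taylor p m)) {0..2*pi}" for m
    proof -
      have "((\<lambda>u. p u / (u - 0) ^ Suc m) has_contour_integral
              2 * pi * \<i> / fact m * (deriv ^^ m) p 0) (circlepath 0 r)"
        by (rule Cauchy_has_contour_integral_higher_derivative_circlepath[OF cont holb]) (use r in auto)
      then have "((\<lambda>t. p (of_real r * cis t) / (of_real r * cis t) ^ Suc m * r * \<i> * cis t) has_integral
                    2 * pi * \<i> * taylor p m) {0..2*pi}"
        unfolding circlepath_def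
        by (subst (asm) has_contour_integral_part_circlepath_iff) (auto simp: fps_expansion_def)
      from has_integral_mult_right[OF this, of "of_real (r ^ m) / \<i>"]
      have "((\<lambda>t. of_real (r ^ m) / \<i> * (p (of_real r * cis t) / (of_real r * cis t) ^ Suc m * r * \<i> * cis t))
              has_integral (2 * pi * r ^ m * taylor p m)) {0..2*pi}"
        by (simp add: field_simps)
      moreover have "of_real (r ^ m) / \<i> * (p (of_real r * cis t) / (of_real r * cis t) ^ Suc m * r * \<i> * cis t)
               = q t * cis (- (real m * t))" for t
      proof -
        have "cis (- (real m * t)) = inverse (cis t ^ m)"
          by (simp add: Complex.DeMoivre flip: cis_inverse)
        then show ?thesis using r by (simp add: q_def field_simps)
      qed
      ultimately show ?thesis by simp
    qed
    have "((\<lambda>u. p u * u ^ (n - 1)) has_contour_integral 0) (circlepath 0 r)"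
      by (rule Cauchy_theorem_convex_simple[where S = unit_disc])
        (use r hol in \<open>auto intro!: holomorphic_intros simp: path_image_circlepath_nonneg\<close>)
    then have "((\<lambda>t. p (of_real r * cis t) * (of_real r * cis t) ^ (n - 1) * r * \<i> * cis t)
                 has_integral 0) {0..2*pi}"
      unfolding circlepath_def
      by (subst (asm) has_contour_integral_part_circlepath_iff) auto
    from has_integral_mult_right[OF this, of "1 / (\<i> * of_real (r ^ n))"]
    have "((\<lambda>t. 1 / (\<i> * of_real (r ^ n)) * (p (of_real r * cis t) * (of_real r * cis t) ^ (n - 1) * r * \<i> * cis t))
                 has_integral 0) {0..2*pi}" by simp
    moreover have "1 / (\<i> * of_real (r ^ n)) * (p (of_real r * cis t) * (of_real r * cis t) ^ (n - 1) * r * \<i> * cis t)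
           = q t * cis (real n * t)" for t
    proof -
      obtain m where m: "n = Suc m" using n by (cases n) auto
      have "cis (real n * t) = cis t ^ n" by (simp add: Complex.DeMoivre)
      then show ?thesis using r by (simp add: q_def m field_simps)
    qed
    ultimately have "((\<lambda>t. q t * cis (real n * t)) has_integral 0) {0..2*pi}" by simp
    from has_integral_linear[OF this bounded_linear_cnj]
    have "((\<lambda>t. cnj (q t * cis (real n * t))) has_integral 0) {0..2*pi}"
      by (simp add: o_def)
    moreover have twice_Re: "of_real (2 * Re (q t)) * cis (- (real n * t))
        = cnj (q t * cis (real n * t)) + q t * cis (- (real n * t))" for t
      by (simp add: cis_cnj complex_eq_iff algebra_simps)
    \<comment> \<open>adding the vanishing integral replaces \<open>p\<close> by \<open>2 Re p\<close>\<close>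
    ultimately have int: "((\<lambda>t. of_real (2 * Re (q t)) * cis (- (real n * t))) has_integral (2 * pi * r ^ n * taylor p n)) {0..2*pi}"
      using has_integral_add[OF _ coeff[of n]] unfolding twice_Re by fastforce
    have "((\<lambda>t. q t) has_integral (2 * pi * p 0)) {0..2*pi}"
      using coeff[of 0] by (simp add: fps_expansion_def)
    then have "((\<lambda>t. Re (q t)) has_integral Re (2 * pi * p 0)) {0..2*pi}"
      by (rule has_integral_Re)
    from has_integral_mult_right[OF this, of 2]
    have int0: "((\<lambda>t. 2 * Re (q t)) has_integral (2 * pi * (2 * Re (p 0)))) {0..2*pi}" by simp
    have "norm (2 * pi * r ^ n * taylor p n) \<le> 2 * pi * (2 * Re (p 0))"
    proof -
      have "norm (integral {0..2*pi} (\<lambda>t. of_real (2 * Re (q t)) * cis (- (real n * t))))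
              \<le> integral {0..2*pi} (\<lambda>t. 2 * Re (q t))"
        by (rule integral_norm_bound_integral)
          (use int int0 r pos in \<open>auto simp: q_def norm_mult has_integral_integrable\<close>)
      then show ?thesis unfolding integral_unique[OF int] integral_unique[OF int0] .
    qed
    then show ?thesis using r by (simp add: norm_mult norm_power)
  qed
  have "((\<lambda>r. r ^ n * norm (taylor p n)) \<longlongrightarrow> 1 ^ n * norm (taylor p n)) (at_left 1)"
    by (intro tendsto_intros)
  moreover have "\<forall>\<^sub>F r in at_left (1::real). r ^ n * norm (taylor p n) \<le> 2 * Re (p 0)"
    using eventually_at_left_real[of 0 1] by (auto elim!: eventually_mono intro: circ)
  ultimately show ?thesis
    using tendsto_upperbound[of _ _ "at_left (1::real)"] by fastforce
qed

text \<open>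
  With \<open>\<omega> = z h\<close>, the function \<open>1 - u h\<close> has nonnegative real part for unimodular \<open>u\<close>; choosing \<open>u\<close> so
  that \<open>u h(0) = |h(0)|\<close>, the coefficients of \<open>h\<close> after the first are at most \<open>2 (1 - |h(0)|)\<close>, and the
  geometric series with ratio \<open>1/3\<close> exactly absorbs the factor 2. Partial sums are used because
  they remain submultiplicative, so that the bound passes to powers of \<open>\<omega>\<close>.
\<close>
lemma bohr_inequality_schwarz:
  assumes hol: "\<omega> holomorphic_on unit_disc" and im: "\<omega> ` unit_disc \<subseteq> unit_disc" and 0: "\<omega> 0 = 0"
    and r: "0 \<le> r" "r \<le> 1 / 3"
  shows "(\<Sum>k<K. norm (taylor \<omega> k) * r ^ k) \<le> r"
proof -
  obtain h where h: "h holomorphic_on unit_disc" "\<And>z. norm z < 1 \<Longrightarrow> \<omega> z = z * h z" "deriv \<omega> 0 = h 0"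
    using Schwarz3[OF hol 0] by blast
  have h_le: "norm (h z) \<le> 1" if "norm z < 1" for z
  proof (cases "z = 0")
    case True
    then show ?thesis using Schwarz_Lemma(2)[OF hol 0 _ that] im h by (auto simp: image_subset_iff)
  next
    case False
    have "norm (\<omega> z) \<le> norm z" using Schwarz_Lemma(1)[OF hol 0 _ that] im by (auto simp: image_subset_iff)
    then show ?thesis using False h(2)[OF that] by (simp add: norm_mult)
  qed
  have hexp: "h has_fps_expansion fps_expansion h 0"
    using h(1) by (intro has_fps_expansion_fps_expansion[of unit_disc]) auto
  have "\<omega> has_fps_expansion fps_X * fps_expansion h 0"
  proof -
    have "(\<lambda>z. z * h z) has_fps_expansion fps_X * fps_expansion h 0"
      by (intro fps_expansion_intros hexp)
    moreover have ev: "\<forall>\<^sub>F z in nhds 0. z * h z = \<omega> z"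
      by (rule eventually_mono[OF eventually_nhds_in_open[of unit_disc]]) (use h in auto)
    ultimately show ?thesis using has_fps_expansion_cong[OF ev refl] by blast
  qed
  then have shift: "taylor \<omega> (Suc k) = taylor h k" and zero: "taylor \<omega> 0 = 0" for k
    by (simp_all add: fps_expansion_eqI)
  define c where "c = norm (h 0)"
  have c1: "c \<le> 1" using h_le[of 0] by (simp add: c_def)
  have coeff: "norm (taylor h (Suc k)) \<le> 2 * (1 - c)" for k
  proof -
    define u where "u = (if h 0 = 0 then 1 else cnj (sgn (h 0)))"
    have u: "norm u = 1" "u * h 0 = of_real c"
    proof -
      show "norm u = 1" by (simp add: u_def norm_sgn)
      show "u * h 0 = of_real c"
        by (simp add: u_def c_def sgn_eq complex_norm_square[symmetric] power2_eq_square mult.commute)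
    qed
    define p where "p z = 1 - u * h z" for z
    have "norm (taylor p (Suc k)) \<le> 2 * Re (p 0)"
    proof (rule caratheodory_coefficient_bound)
      show "p holomorphic_on unit_disc" unfolding p_def by (intro holomorphic_intros h)
      fix z :: complex assume z: "z \<in> unit_disc"
      have "Re (u * h z) \<le> norm (u * h z)" by (rule complex_Re_le_cmod)
      also have "\<dots> \<le> 1" using h_le[of z] z u by (simp add: norm_mult)
      finally show "0 \<le> Re (p z)" by (simp add: p_def)
    qed simp
    moreover have "p has_fps_expansion 1 - fps_const u * fps_expansion h 0"
      unfolding p_def by (intro fps_expansion_intros hexp)
    then have "taylor p (Suc k) = - u * taylor h (Suc k)"
      by (simp add: fps_expansion_eqI)
    ultimately show ?thesis using u by (simp add: p_def norm_mult)
  qed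
  have geom: "(\<Sum>k<m. r ^ Suc k) \<le> 1 / 2" for m
  proof -
    have "(\<Sum>k<m. r ^ Suc k) \<le> (\<Sum>k<m. (1/3) ^ Suc k)"
      using r by (intro sum_mono power_mono) auto
    also have "\<dots> = (1 - (1/3) ^ m) / 2"
      by (induction m) (simp_all add: diff_divide_distrib)
    also have "\<dots> \<le> 1 / 2" by simp
    finally show ?thesis .
  qed
  have h_sum: "(\<Sum>k<m. norm (taylor h k) * r ^ k) \<le> 1" for m
  proof (cases m)
    case (Suc m')
    have "(\<Sum>k<m'. norm (taylor h (Suc k)) * r ^ Suc k) \<le> (\<Sum>k<m'. 2 * (1 - c) * r ^ Suc k)"
      using r by (intro sum_mono mult_right_mono coeff) auto
    also have "\<dots> = 2 * (1 - c) * (\<Sum>k<m'. r ^ Suc k)" by (rule sum_distrib_left[symmetric])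
    also have "\<dots> \<le> 2 * (1 - c) * (1 / 2)"
      using c1 geom by (intro mult_left_mono) auto
    finally have "(\<Sum>k<m'. norm (taylor h (Suc k)) * r ^ Suc k) \<le> 1 - c" by simp
    then show ?thesis unfolding Suc sum.lessThan_Suc_shift
      by (simp add: c_def fps_expansion_def)
  qed simp
  show ?thesis
  proof (cases K)
    case (Suc m)
    have "(\<Sum>k<K. norm (taylor \<omega> k) * r ^ k) = r * (\<Sum>k<m. norm (taylor h k) * r ^ k)"
      unfolding Suc sum.lessThan_Suc_shift by (simp add: shift zero sum_distrib_left mult_ac)
    also have "\<dots> \<le> r * 1" using r h_sum by (intro mult_left_mono) auto
    finally show ?thesis by simp
  qed (use r in simp)
qed

lemma partial_majorant_mult_le:
  fixes A B :: "complex fps"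
  assumes "0 \<le> r"
  shows "(\<Sum>k<K. norm (fps_nth (A * B) k) * r ^ k)
           \<le> (\<Sum>k<K. norm (fps_nth A k) * r ^ k) * (\<Sum>k<K. norm (fps_nth B k) * r ^ k)"
proof -
  define a b where "a k = norm (fps_nth A k) * r ^ k" and "b k = norm (fps_nth B k) * r ^ k" for k
  have nn: "a k \<ge> 0" "b k \<ge> 0" for k using assms by (simp_all add: a_def b_def)
  have "(\<Sum>k<K. norm (fps_nth (A * B) k) * r ^ k) \<le> (\<Sum>k<K. \<Sum>i\<le>k. a i * b (k - i))"
  proof (rule sum_mono)
    fix k
    have "norm (fps_nth (A * B) k) \<le> (\<Sum>i=0..k. norm (fps_nth A i) * norm (fps_nth B (k - i)))"
      unfolding fps_mult_nth by (rule order.trans[OF norm_sum]) (simp add: norm_mult)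
    then have "norm (fps_nth (A * B) k) * r ^ k
                 \<le> (\<Sum>i=0..k. norm (fps_nth A i) * norm (fps_nth B (k - i))) * r ^ k"
      using assms by (intro mult_right_mono) auto
    also have "\<dots> = (\<Sum>i\<le>k. a i * b (k - i))"
      unfolding sum_distrib_right atMost_atLeast0
      by (intro sum.cong) (auto simp: a_def b_def power_add[symmetric] mult_ac)
    finally show "norm (fps_nth (A * B) k) * r ^ k \<le> (\<Sum>i\<le>k. a i * b (k - i))" .
  qed
  also have "\<dots> = (\<Sum>(i, j)\<in>{(i, j). i + j < K}. a i * b j)"
    by (rule sum.triangle_reindex[symmetric])
  also have "\<dots> \<le> (\<Sum>(i, j)\<in>{..<K} \<times> {..<K}. a i * b j)"
    by (rule sum_mono2) (auto intro: mult_nonneg_nonneg nn)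
  also have "\<dots> = (\<Sum>k<K. a k) * (\<Sum>k<K. b k)"
    by (simp add: sum.cartesian_product sum_product)
  finally show ?thesis by (simp add: a_def b_def)
qed

lemma taylor_sums:
  assumes "f holomorphic_on unit_disc" "norm z < 1"
  shows "(\<lambda>n. taylor f n * z ^ n) sums f z"
  using has_fps_expansion_imp_sums_complex[of f _ 1 z] assms
    has_fps_expansion_fps_expansion[of unit_disc f]
  by (simp add: one_ereal_def)

lemma summable_norm_taylor:
  assumes f: "f holomorphic_on unit_disc" and "\<bar>r\<bar> < 1"
  shows "summable (\<lambda>n. norm (taylor f n) * r ^ n)"
proof -
  obtain s where s: "\<bar>r\<bar> < s" "s < 1" using assms(2) dense by blast
  have "summable (\<lambda>n. taylor f n * of_real s ^ n)"
    using taylor_sums[OF f, of "of_real s"] s by (auto simp: sums_iff)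
  then have "summable (\<lambda>n. norm (taylor f n * of_real r ^ n))"
    by (rule powser_insidea) (use s in auto)
  then have "summable (\<lambda>n. \<bar>norm (taylor f n) * r ^ n\<bar>)"
    by (simp add: norm_mult norm_power abs_mult power_abs)
  then show ?thesis by (rule summable_rabs_cancel)
qed

lemma sum_le_majorant:
  assumes "f holomorphic_on unit_disc" "0 \<le> r" "r < 1"
  shows "(\<Sum>k<K. norm (taylor f k) * r ^ k) \<le> majorant f r"
  unfolding majorant_def
  by (rule sum_le_suminf) (use assms in \<open>auto intro: summable_norm_taylor\<close>)

lemma majorant_le:
  assumes "f holomorphic_on unit_disc" "0 \<le> r" "r < 1"
    and "\<And>K. (\<Sum>k<K. norm (taylor f k) * r ^ k) \<le> C"
  shows "majorant f r \<le> C"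
  unfolding majorant_def
  by (rule suminf_le_const) (use assms in \<open>auto intro: summable_norm_taylor\<close>)

lemma majorant_nonneg:
  assumes "f holomorphic_on unit_disc" "0 \<le> r" "r < 1"
  shows "0 \<le> majorant f r"
  using sum_le_majorant[OF assms, of 0] by simp

lemma majorant_mult_le:
  assumes f: "f holomorphic_on unit_disc" and g: "g holomorphic_on unit_disc" and r: "0 \<le> r" "r < 1"
  shows "majorant (\<lambda>z. f z * g z) r \<le> majorant f r * majorant g r"
proof (rule majorant_le)
  show "(\<lambda>z. f z * g z) holomorphic_on unit_disc" by (intro holomorphic_intros f g)
  fix K
  have "(\<lambda>z. f z * g z) has_fps_expansion fps_expansion f 0 * fps_expansion g 0"
    using f g by (intro fps_expansion_intros has_fps_expansion_fps_expansion[of unit_disc]) auto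
  then have "fps_expansion (\<lambda>z. f z * g z) 0 = fps_expansion f 0 * fps_expansion g 0"
    by (rule fps_expansion_eqI)
  then have "(\<Sum>k<K. norm (taylor (\<lambda>z. f z * g z) k) * r ^ k)
      \<le> (\<Sum>k<K. norm (taylor f k) * r ^ k) * (\<Sum>k<K. norm (taylor g k) * r ^ k)"
    using partial_majorant_mult_le[OF r(1)] by simp
  also have "\<dots> \<le> majorant f r * majorant g r"
    using r by (intro mult_mono sum_le_majorant majorant_nonneg f g sum_nonneg) auto
  finally show "(\<Sum>k<K. norm (taylor (\<lambda>z. f z * g z) k) * r ^ k) \<le> majorant f r * majorant g r" .
qed (use r in auto)

text \<open>
  Expanding \<open>u = v \<circ> \<omega>\<close> in powers of \<open>\<omega>\<close>, Bohr's inequality bounds the majorant of \<open>\<omega>\<^sup>i\<close> by \<open>r\<^sup>i\<close>,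
  which is what the \<open>i\<close>-th term of the majorant of \<open>v\<close> carries. Finite sums suffice, since the \<open>k\<close>-th
  coefficient of the composition involves only powers up to \<open>k\<close>.
\<close>
lemma majorant_subordinate_le:
  assumes hol: "u holomorphic_on unit_disc" "v holomorphic_on unit_disc"
    and sub: "subordinate u v" and r: "0 \<le> r" "r \<le> 1 / 3"
  shows "majorant u r \<le> majorant v r"
proof (rule majorant_le)
  obtain \<omega> where \<omega>: "\<omega> holomorphic_on unit_disc" "\<omega> ` unit_disc \<subseteq> unit_disc" "\<omega> 0 = 0"
    and uv: "\<And>z. z \<in> unit_disc \<Longrightarrow> u z = v (\<omega> z)"
    using sub by (auto simp: subordinate_def)
  define V W where "V = fps_expansion v 0" and "W = fps_expansion \<omega> 0"
  have V: "v has_fps_expansion V" and W: "\<omega> has_fps_expansion W"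
    unfolding V_def W_def using hol \<omega> by (auto intro!: has_fps_expansion_fps_expansion[of unit_disc])
  have W0: "fps_nth W 0 = 0" using \<omega> by (simp add: W_def fps_expansion_def)
  have "(v \<circ> \<omega>) has_fps_expansion fps_compose V W"
    by (rule has_fps_expansion_compose[OF V W W0])
  moreover have ev: "\<forall>\<^sub>F z in nhds 0. (v \<circ> \<omega>) z = u z"
    by (rule eventually_mono[OF eventually_nhds_in_open[of unit_disc]]) (auto simp: uv)
  ultimately have U: "fps_expansion u 0 = fps_compose V W"
    using has_fps_expansion_cong[OF ev refl] fps_expansion_eqI by blast
  fix K
  have pow: "(\<Sum>k<K. norm (fps_nth (W ^ i) k) * r ^ k) \<le> r ^ i" for i
  proof (induction i)
    case 0
    have "(\<Sum>k<K. norm (fps_nth (1 :: complex fps) k) * r ^ k) \<le> (\<Sum>k<K. if k = 0 then 1 else 0)"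
      by (intro sum_mono) auto
    then show ?case by (auto simp: sum.delta split: if_splits)
  next
    case (Suc i)
    have "(\<Sum>k<K. norm (fps_nth (W ^ Suc i) k) * r ^ k)
       \<le> (\<Sum>k<K. norm (fps_nth W k) * r ^ k) * (\<Sum>k<K. norm (fps_nth (W ^ i) k) * r ^ k)"
      using partial_majorant_mult_le[OF r(1), of W "W ^ i" K] by simp
    also have "\<dots> \<le> r * r ^ i"
      using bohr_inequality_schwarz[OF \<omega> r] r Suc.IH unfolding W_def[symmetric]
      by (intro mult_mono sum_nonneg) auto
    finally show ?case by simp
  qed
  have "(\<Sum>k<K. norm (taylor u k) * r ^ k)
      \<le> (\<Sum>k<K. \<Sum>i<K. norm (fps_nth V i) * (norm (fps_nth (W ^ i) k) * r ^ k))"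
  proof (rule sum_mono)
    fix k assume k: "k \<in> {..<K}"
    have "norm (taylor u k) * r ^ k \<le> (\<Sum>i=0..k. norm (fps_nth V i) * norm (fps_nth (W ^ i) k)) * r ^ k"
      unfolding U fps_compose_nth using r
      by (intro mult_right_mono order.trans[OF norm_sum]) (auto simp: norm_mult)
    also have "\<dots> = (\<Sum>i=0..k. norm (fps_nth V i) * (norm (fps_nth (W ^ i) k) * r ^ k))"
      unfolding sum_distrib_right by (intro sum.cong) (simp_all add: mult_ac)
    also have "\<dots> \<le> (\<Sum>i<K. norm (fps_nth V i) * (norm (fps_nth (W ^ i) k) * r ^ k))"
      using k r by (intro sum_mono2) auto
    finally show "norm (taylor u k) * r ^ k
       \<le> (\<Sum>i<K. norm (fps_nth V i) * (norm (fps_nth (W ^ i) k) * r ^ k))" .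
  qed
  also have "\<dots> = (\<Sum>i<K. norm (fps_nth V i) * (\<Sum>k<K. norm (fps_nth (W ^ i) k) * r ^ k))"
    by (subst sum.swap) (simp add: sum_distrib_left)
  also have "\<dots> \<le> (\<Sum>i<K. norm (fps_nth V i) * r ^ i)"
    by (intro sum_mono mult_left_mono pow) auto
  also have "\<dots> \<le> majorant v r" unfolding V_def using hol r by (intro sum_le_majorant) auto
  finally show "(\<Sum>k<K. norm (taylor u k) * r ^ k) \<le> majorant v r" .
qed (use hol r in auto)

section \<open>Convex and close-to-convex functions\<close>

lemma has_real_derivative_Re_along_path:
  assumes "(\<gamma> has_vector_derivative v) (at t)" "(F has_field_derivative D) (at (\<gamma> t))"
  shows "((\<lambda>t. Re (c * F (\<gamma> t))) has_real_derivative Re (c * D * v)) (at t)"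
proof -
  have "((\<lambda>t. F (\<gamma> t)) has_vector_derivative v * D) (at t)"
    using field_vector_diff_chain_at[OF assms] by (simp add: o_def)
  then have "((\<lambda>t. c * F (\<gamma> t)) has_vector_derivative c * (v * D)) (at t)"
    by (rule has_vector_derivative_mult_right)
  from bounded_linear.has_vector_derivative[OF bounded_linear_Re this] show ?thesis
    by (simp add: has_real_derivative_iff_has_vector_derivative mult_ac)
qed

lemma cis_path_has_vector_derivative:
  "((\<lambda>s. z * cis s) has_vector_derivative \<i> * (z * cis s)) (at s)"
proof -
  have "((\<lambda>s. z * cis s) has_vector_derivative z * (\<i> * cis s)) (at s)"
    by (rule has_vector_derivative_mult_right)
      (auto simp: has_vector_derivative_complex_iff intro!: derivative_eq_intros)
  then show ?thesis by (simp add: mult_ac)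
qed

text \<open>
  If the real part vanished at one point, \<open>exp (- u)\<close> would attain its maximal modulus there and be
  constant.
\<close>
lemma Re_pos_of_nonneg:
  assumes hol: "u holomorphic_on unit_disc" and nn: "\<And>z. z \<in> unit_disc \<Longrightarrow> 0 \<le> Re (u z)"
    and pos: "0 < Re (u 0)" and \<xi>: "\<xi> \<in> unit_disc"
  shows "0 < Re (u \<xi>)"
proof (rule ccontr)
  assume "\<not> 0 < Re (u \<xi>)"
  with nn \<xi> have Re0: "Re (u \<xi>) = 0" by force
  have "(\<lambda>z. exp (- u z)) constant_on unit_disc"
  proof (rule maximum_modulus_principle)
    show "(\<lambda>z. exp (- u z)) holomorphic_on unit_disc" by (intro holomorphic_intros hol)
    show "norm (exp (- u z)) \<le> norm (exp (- u \<xi>))" if "z \<in> unit_disc" for z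
      using nn[OF that] Re0 by simp
  qed (use \<xi> in auto)
  then have "exp (- u \<xi>) = exp (- u 0)" using \<xi> unfolding constant_on_def by force
  then have "norm (exp (- u \<xi>)) = norm (exp (- u 0))" by simp
  then show False using Re0 pos by simp
qed

text \<open>
  The analytic form of convexity. The geometric consequences (supporting lines, univalence, convexity
  of the image) are derived below.
\<close>
definition convex_function :: "(complex \<Rightarrow> complex) \<Rightarrow> bool" where
  "convex_function H \<longleftrightarrow> H holomorphic_on unit_disc \<and>
     (\<forall>z\<in>unit_disc. deriv H z \<noteq> 0 \<and> 0 < Re (1 + z * deriv (deriv H) z / deriv H z))"

text \<open>
  The curve \<open>s \<mapsto> H (z\<^sub>1 cis s)\<close> has its tangent turning monotonically through a total angle of \<open>2 \<pi>\<close>.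
  So its height over the tangent line at \<open>s = 0\<close> first strictly decreases, while the tangent has turned
  by less than \<open>\<pi>\<close>, and then strictly increases back to zero.
\<close>
lemma convex_function_support_circle:
  assumes H: "convex_function H" and z1: "norm z\<^sub>1 < 1" and z: "norm z = norm z\<^sub>1" "z \<noteq> z\<^sub>1"
  shows "Re (cnj (z\<^sub>1 * deriv H z\<^sub>1) * (H z - H z\<^sub>1)) < 0"
proof -
  have hol: "H holomorphic_on unit_disc" and nz: "\<And>z. z \<in> unit_disc \<Longrightarrow> deriv H z \<noteq> 0"
    and cvx: "\<And>z. z \<in> unit_disc \<Longrightarrow> 0 < Re (1 + z * deriv (deriv H) z / deriv H z)"
    using H by (auto simp: convex_function_def)
  have hol': "deriv H holomorphic_on unit_disc" by (intro holomorphic_deriv hol) auto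
  obtain q where q: "q holomorphic_on unit_disc" "\<And>z. z \<in> unit_disc \<Longrightarrow> exp (q z) = deriv H z"
    by (rule holomorphic_logarithm_exists[OF convex_ball open_ball hol' nz, of 0]) auto
  have dH: "(H has_field_derivative exp (q w)) (at w)" if "w \<in> unit_disc" for w
    using holomorphic_derivI[OF hol _ that] q(2)[OF that] by auto
  have dq: "(q has_field_derivative deriv (deriv H) w / deriv H w) (at w)" if w: "w \<in> unit_disc" for w
  proof -
    have 1: "(q has_field_derivative deriv q w) (at w)"
      using holomorphic_derivI[OF q(1) _ w] by auto
    have "((\<lambda>z. exp (q z)) has_field_derivative exp (q w) * deriv q w) (at w)"
      by (rule derivative_eq_intros 1 refl)+
    moreover have "((\<lambda>z. exp (q z)) has_field_derivative deriv (deriv H) w) (at w)"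
      by (rule has_field_derivative_transform_within_open[OF holomorphic_derivI[OF hol' open_ball w] open_ball w])
        (use q(2) in auto)
    ultimately have "exp (q w) * deriv q w = deriv (deriv H) w" by (rule DERIV_unique)
    then have "deriv q w = deriv (deriv H) w / deriv H w" using q(2)[OF w] nz[OF w]
      by (simp add: field_simps)
    then show ?thesis using 1 by simp
  qed
  define r where "r = norm z\<^sub>1"
  have z10: "z\<^sub>1 \<noteq> 0" using z by auto
  then have r0: "0 < r" by (simp add: r_def)
  define w where "w s = z\<^sub>1 * cis s" for s
  have w_in: "w s \<in> unit_disc" for s using z1 by (simp add: w_def norm_mult)
  have w_der: "(w has_vector_derivative \<i> * w s) (at s)" for s
    unfolding w_def by (rule cis_path_has_vector_derivative)
  \<comment> \<open>the angle by which the tangent has turned since \<open>s = 0\<close>\<close>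
  define \<theta> where "\<theta> s = s + Im (q (w s) - q z\<^sub>1)" for s
  have \<theta>_der: "(\<theta> has_real_derivative Re (1 + w s * deriv (deriv H) (w s) / deriv H (w s))) (at s)" for s
  proof -
    have "((\<lambda>s. Re (- \<i> * q (w s))) has_real_derivative
             Re (- \<i> * (deriv (deriv H) (w s) / deriv H (w s)) * (\<i> * w s))) (at s)"
      by (rule has_real_derivative_Re_along_path[OF w_der dq[OF w_in]])
    then have "((\<lambda>s. s + Re (- \<i> * q (w s)) - Im (q z\<^sub>1)) has_real_derivative
             1 + Re (- \<i> * (deriv (deriv H) (w s) / deriv H (w s)) * (\<i> * w s)) - 0) (at s)"
      by (intro DERIV_add DERIV_diff DERIV_ident DERIV_const)
    moreover have "(\<lambda>s. s + Re (- \<i> * q (w s)) - Im (q z\<^sub>1)) = \<theta>" by (auto simp: \<theta>_def fun_eq_iff)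
    moreover have "- \<i> * (deriv (deriv H) (w s) / deriv H (w s)) * (\<i> * w s)
        = w s * deriv (deriv H) (w s) / deriv H (w s)" by (simp add: mult_ac)
    ultimately show ?thesis by (simp only: diff_zero plus_complex.sel one_complex.sel)
  qed
  have \<theta>_mono: "\<theta> s < \<theta> t" if "s < t" for s t
    by (rule DERIV_pos_imp_increasing[OF that]) (use \<theta>_der cvx[OF w_in] in blast)
  have \<theta>0: "\<theta> 0 = 0" and \<theta>2: "\<theta> (2 * pi) = 2 * pi" by (simp_all add: \<theta>_def w_def)
  have "continuous_on {0..2*pi} \<theta>"
    using \<theta>_der by (meson DERIV_atLeastAtMost_imp_continuous_on)
  then obtain m where m: "0 \<le> m" "m \<le> 2 * pi" "\<theta> m = pi"
    using IVT'[of \<theta> 0 pi "2 * pi"] \<theta>0 \<theta>2 by auto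
  \<comment> \<open>signed distance to the tangent line at \<open>s = 0\<close>, up to a positive factor\<close>
  define V where "V s = Re (cnj (z\<^sub>1 * deriv H z\<^sub>1) * (H (w s) - H z\<^sub>1))" for s
  define A where "A s = r ^ 2 * exp (Re (q (w s) + q z\<^sub>1))" for s
  have A: "A s > 0" for s using r0 by (simp add: A_def)
  have V_der: "(V has_real_derivative - A s * sin (\<theta> s)) (at s)" for s
  proof -
    have "((\<lambda>s. Re (cnj (z\<^sub>1 * deriv H z\<^sub>1) * H (w s))) has_real_derivative
             Re (cnj (z\<^sub>1 * deriv H z\<^sub>1) * exp (q (w s)) * (\<i> * w s))) (at s)"
      by (rule has_real_derivative_Re_along_path[OF w_der dH[OF w_in]])
    then have "((\<lambda>s. Re (cnj (z\<^sub>1 * deriv H z\<^sub>1) * H (w s)) - Re (cnj (z\<^sub>1 * deriv H z\<^sub>1) * H z\<^sub>1)) has_real_derivative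
             Re (cnj (z\<^sub>1 * deriv H z\<^sub>1) * exp (q (w s)) * (\<i> * w s)) - 0) (at s)"
      by (intro DERIV_diff DERIV_const)
    moreover have "(\<lambda>s. Re (cnj (z\<^sub>1 * deriv H z\<^sub>1) * H (w s)) - Re (cnj (z\<^sub>1 * deriv H z\<^sub>1) * H z\<^sub>1)) = V"
      by (auto simp: V_def fun_eq_iff algebra_simps)
    moreover have "cnj (z\<^sub>1 * deriv H z\<^sub>1) * exp (q (w s)) * (\<i> * w s) = \<i> * of_real (A s) * cis (\<theta> s)"
    proof -
      have "cnj (z\<^sub>1 * deriv H z\<^sub>1) * exp (q (w s)) * (\<i> * w s)
          = (z\<^sub>1 * cnj z\<^sub>1) * (\<i> * (exp (cnj (q z\<^sub>1)) * exp (q (w s)) * cis s))"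
        using q(2)[of z\<^sub>1, symmetric] z1 by (simp add: w_def exp_cnj mult_ac)
      also have "z\<^sub>1 * cnj z\<^sub>1 = of_real (r ^ 2)" by (simp add: r_def complex_norm_square[symmetric])
      also have "exp (cnj (q z\<^sub>1)) * exp (q (w s)) * cis s
          = of_real (exp (Re (q (w s) + q z\<^sub>1))) * cis (\<theta> s)"
      proof -
        have "cis (\<theta> s) = cis (Im (cnj (q z\<^sub>1))) * cis (Im (q (w s))) * cis s"
          by (simp add: cis_mult \<theta>_def algebra_simps)
        then show ?thesis
          unfolding exp_eq_polar[of "cnj (q z\<^sub>1)"] exp_eq_polar[of "q (w s)"]
          by (simp add: exp_add mult_ac)
      qed
      finally show ?thesis by (simp add: A_def)
    qed
    moreover have "Re (\<i> * of_real (A s) * cis (\<theta> s)) - 0 = - A s * sin (\<theta> s)" by simp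
    ultimately show ?thesis by (simp only:)
  qed
  have V_cont: "continuous_on {a..b} V" for a b
    using V_der by (meson DERIV_atLeastAtMost_imp_continuous_on)
  have V0: "V 0 = 0" and V2: "V (2 * pi) = 0" by (simp_all add: V_def w_def)
  have V_neg: "V s < 0" if s: "0 < s" "s < 2 * pi" for s
  proof (cases "s \<le> m")
    case True
    have "V s < V 0"
    proof (rule DERIV_neg_imp_decreasing_open[OF s(1) _ V_cont])
      fix x assume x: "0 < x" "x < s"
      have "sin (\<theta> x) > 0" using \<theta>_mono[of 0 x] \<theta>_mono[of x m] x True m \<theta>0 by (intro sin_gt_zero) auto
      then show "\<exists>y. DERIV V x :> y \<and> y < 0" using V_der[of x] A[of x] by (intro exI conjI) auto
    qed
    then show ?thesis using V0 by simp
  next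
    case False
    have "V s < V (2 * pi)"
    proof (rule DERIV_pos_imp_increasing_open[OF s(2) _ V_cont])
      fix x assume x: "s < x" "x < 2 * pi"
      have "sin (\<theta> x) < 0" using \<theta>_mono[of x "2*pi"] \<theta>_mono[of m x] x False m \<theta>2 by (intro sin_lt_zero) auto
      then have "- A x * sin (\<theta> x) > 0" using A[of x] by (simp add: mult_pos_neg)
      then show "\<exists>y. DERIV V x :> y \<and> y > 0" using V_der[of x] by blast
    qed
    then show ?thesis using V2 by simp
  qed
  define s where "s = Arg2pi (z / z\<^sub>1)"
  have s: "z / z\<^sub>1 = cis s" "0 \<le> s" "s < 2 * pi"
    using Arg2pi[of "z / z\<^sub>1"] z z10 by (auto simp: s_def is_Arg_def norm_divide cis_conv_exp)
  then have zw: "z = w s" using z10 by (simp add: w_def field_simps)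
  with z(2) have "s \<noteq> 0" by (auto simp: w_def)
  with V_neg s zw show ?thesis by (simp add: V_def)
qed

text \<open>
  The strict supporting half-plane at a boundary point of the image of a disc; the points inside
  follow from those on the circle by the maximum principle for the exponential.
\<close>
lemma convex_function_support:
  assumes H: "convex_function H" and z1: "norm z\<^sub>1 < 1" and z: "norm z \<le> norm z\<^sub>1" "z \<noteq> z\<^sub>1"
  shows "Re (cnj (z\<^sub>1 * deriv H z\<^sub>1) * (H z - H z\<^sub>1)) < 0"
proof (cases "norm z = norm z\<^sub>1")
  case True
  then show ?thesis using convex_function_support_circle[OF H z1] z by blast
next
  case False
  define r where "r = norm z\<^sub>1"
  have r: "norm z < r" "r < 1" "0 < r" using False z z1 norm_ge_zero[of z] unfolding r_def by linarith+
  have hol: "H holomorphic_on unit_disc" and nz: "\<And>z. z \<in> unit_disc \<Longrightarrow> deriv H z \<noteq> 0"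
    using H by (auto simp: convex_function_def)
  define c where "c = cnj (z\<^sub>1 * deriv H z\<^sub>1)"
  have c: "c \<noteq> 0" using nz[of z\<^sub>1] z1 r by (auto simp: c_def r_def)
  define E where "E w = exp (c * (H w - H z\<^sub>1))" for w
  have holE: "E holomorphic_on unit_disc" unfolding E_def by (intro holomorphic_intros hol)
  have le1: "norm (E w) \<le> 1" if "norm w \<le> r" for w
  proof (rule maximum_modulus_frontier[of E "cball 0 r"])
    show "E holomorphic_on interior (cball 0 r)"
      using r by (intro holomorphic_on_subset[OF holE]) auto
    show "continuous_on (closure (cball 0 r)) E"
      using r by (intro holomorphic_on_imp_continuous_on holomorphic_on_subset[OF holE]) auto
    fix v :: complex assume "v \<in> frontier (cball 0 r)"
    then have "norm v = norm z\<^sub>1" using r by (simp add: r_def)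
    then show "norm (E v) \<le> 1"
      using convex_function_support_circle[OF H z1, of v] by (cases "v = z\<^sub>1") (auto simp: E_def c_def)
  qed (use that in auto)
  have "norm (E z) < 1"
  proof (rule ccontr)
    assume "\<not> norm (E z) < 1"
    then have "norm (E w) \<le> norm (E z)" if "w \<in> ball 0 r" for w using le1[of w] that by auto
    then have "E constant_on ball 0 r"
      using r by (intro maximum_modulus_principle[of E "ball 0 r" "ball 0 r" z] holomorphic_on_subset[OF holE]) auto
    then obtain C where C: "\<And>w. w \<in> ball 0 r \<Longrightarrow> E w = C" unfolding constant_on_def by auto
    have "(E has_field_derivative 0) (at 0)"
      by (rule has_field_derivative_transform_within_open[of "\<lambda>_. C" 0 0 "ball 0 r"]) (use r C in auto)
    moreover have "(E has_field_derivative E 0 * (c * deriv H 0)) (at 0)"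
    proof -
      have 1: "(H has_field_derivative deriv H 0) (at 0)" using holomorphic_derivI[OF hol, of 0] by auto
      show ?thesis unfolding E_def
        by (rule derivative_eq_intros 1 refl)+ simp
    qed
    ultimately have "E 0 * (c * deriv H 0) = 0" using DERIV_unique by blast
    then show False using c nz[of 0] by (simp add: E_def)
  qed
  then show ?thesis by (simp add: E_def c_def)
qed

text \<open>
  Two points with the same value cannot satisfy the strict support inequality, taken at the one of
  larger modulus.
\<close>
lemma convex_function_inj_on:
  assumes H: "convex_function H"
  shows "inj_on H unit_disc"
proof (rule inj_onI, rule ccontr)
  fix x y :: complex assume *: "x \<in> unit_disc" "y \<in> unit_disc" "H x = H y" "x \<noteq> y"
  then show False
    using convex_function_support[OF H, of x y] convex_function_support[OF H, of y x]
    by (cases "norm x \<le> norm y") auto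
qed

text \<open>
  A segment between two points of the image cannot meet the image of the bounding circle, since at
  such a point both ends would lie strictly on one side of the supporting line. Being connected, the
  segment then stays inside.
\<close>
lemma convex_function_image_ball:
  assumes H: "convex_function H" and r: "0 < r" "r < 1"
  shows "convex (H ` ball 0 r)"
proof (rule convexI)
  fix X Y :: complex and u v :: real
  assume XY: "X \<in> H ` ball 0 r" "Y \<in> H ` ball 0 r" and uv: "0 \<le> u" "0 \<le> v" "u + v = 1"
  obtain x y where x: "norm x < r" "X = H x" and y: "norm y < r" "Y = H y" using XY by auto
  have hol: "H holomorphic_on unit_disc" using H by (simp add: convex_function_def)
  define L where "L = closed_segment X Y"
  have avoid: "\<not> (norm \<zeta> = r \<and> H \<zeta> \<in> L)" for \<zeta>
  proof (rule notI, elim conjE)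
    assume \<zeta>: "norm \<zeta> = r" "H \<zeta> \<in> L"
    define c where "c = cnj (\<zeta> * deriv H \<zeta>)"
    obtain t where t: "0 \<le> t" "t \<le> 1" "H \<zeta> = (1 - t) *\<^sub>R X + t *\<^sub>R Y"
      using \<zeta> by (auto simp: L_def closed_segment_def)
    have "Re (c * (X - H \<zeta>)) < 0" "Re (c * (Y - H \<zeta>)) < 0"
      unfolding c_def x y by (rule convex_function_support[OF H]; use x y \<zeta> r in auto)+
    then have "(1 - t) * Re (c * (X - H \<zeta>)) + t * Re (c * (Y - H \<zeta>)) < 0"
      using t by (cases "t = 0") (auto simp: add_nonpos_neg mult_nonneg_nonpos mult_pos_neg)
    also have "(1 - t) * Re (c * (X - H \<zeta>)) + t * Re (c * (Y - H \<zeta>))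
        = Re (c * (((1 - t) *\<^sub>R X + t *\<^sub>R Y) - H \<zeta>))"
      by (simp add: scaleR_conv_of_real algebra_simps)
    also have "\<dots> = 0" using t by simp
    finally show False by simp
  qed
  have "compact (H ` cball 0 r)"
    using r by (intro compact_continuous_image holomorphic_on_imp_continuous_on holomorphic_on_subset[OF hol]) auto
  then have cl: "open (- (H ` cball 0 r))" using compact_imp_closed by blast
  have op: "open (H ` ball 0 r)"
    using r by (intro open_mapping_thm3 holomorphic_on_subset[OF hol] inj_on_subset[OF convex_function_inj_on[OF H]]) auto
  have "H ` ball 0 r \<inter> L = {} \<or> - (H ` cball 0 r) \<inter> L = {}"
  proof (rule connectedD[OF _ op cl])
    show "connected L" by (simp add: L_def)
    show "H ` ball 0 r \<inter> - (H ` cball 0 r) \<inter> L = {}" by force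
    show "L \<subseteq> H ` ball 0 r \<union> - (H ` cball 0 r)"
    proof
      fix w assume w: "w \<in> L"
      show "w \<in> H ` ball 0 r \<union> - (H ` cball 0 r)"
      proof (cases "w \<in> H ` cball 0 r")
        case True
        then obtain \<zeta> where \<zeta>: "norm \<zeta> \<le> r" "w = H \<zeta>" by auto
        with avoid[of \<zeta>] w have "norm \<zeta> < r" by auto
        with \<zeta> show ?thesis by auto
      qed auto
    qed
  qed
  moreover have "X \<in> L" "X \<in> H ` ball 0 r" using XY by (auto simp: L_def)
  ultimately have "L \<subseteq> H ` cball 0 r" by blast
  moreover have "u *\<^sub>R X + v *\<^sub>R Y \<in> L"
    unfolding L_def closed_segment_def using uv by (auto intro!: exI[of _ v] simp: eq_diff_eq)
  ultimately obtain \<zeta> where "norm \<zeta> \<le> r" "u *\<^sub>R X + v *\<^sub>R Y = H \<zeta>" "H \<zeta> \<in> L" by auto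
  moreover from this avoid[of \<zeta>] have "norm \<zeta> < r" by auto
  ultimately show "u *\<^sub>R X + v *\<^sub>R Y \<in> H ` ball 0 r" by auto
qed

lemma convex_function_image:
  assumes H: "convex_function H"
  shows "convex (H ` unit_disc)"
proof (rule convexI)
  fix X Y :: complex and u v :: real
  assume XY: "X \<in> H ` unit_disc" "Y \<in> H ` unit_disc" and uv: "0 \<le> u" "0 \<le> v" "u + v = 1"
  obtain x y where x: "norm x < 1" "X = H x" and y: "norm y < 1" "Y = H y" using XY by auto
  obtain r where r: "max (norm x) (norm y) < r" "r < 1" using x y dense[of "max (norm x) (norm y)" 1] by auto
  then have "0 < r" using norm_ge_zero[of x] by linarith
  have "u *\<^sub>R X + v *\<^sub>R Y \<in> H ` ball 0 r"
    by (rule convexD[OF convex_function_image_ball[OF H \<open>0 < r\<close> r(2)]]) (use x y uv r in auto)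
  then show "u *\<^sub>R X + v *\<^sub>R Y \<in> H ` unit_disc" using r by auto
qed

text \<open>
  The Noshiro-Warschawski argument on the convex set \<open>g(D)\<close>: there \<open>F \<circ> g\<^sup>-\<^sup>1\<close> has a derivative
  of positive real part, which is integrated along a segment. The difference quotient gives
  univalence of \<open>F\<close>, and with one point fixed at 0 it compares \<open>F\<close> with \<open>g\<close> itself.
\<close>
lemma close_to_convex_difference_quotient:
  assumes g: "convex_function g" and F: "F holomorphic_on unit_disc"
    and pos: "\<And>z. z \<in> unit_disc \<Longrightarrow> 0 < Re (deriv F z / deriv g z)"
    and ab: "a \<in> unit_disc" "b \<in> unit_disc" "a \<noteq> b"
  shows "0 < Re ((F b - F a) / (g b - g a))"
proof -
  have hol: "g holomorphic_on unit_disc" using g by (simp add: convex_function_def)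
  note inj = convex_function_inj_on[OF g]
  obtain j where j: "j holomorphic_on g ` unit_disc"
      "\<And>z. z \<in> unit_disc \<Longrightarrow> deriv g z * deriv j (g z) = 1"
      "\<And>z. z \<in> unit_disc \<Longrightarrow> j (g z) = z"
    using holomorphic_has_inverse[OF hol open_ball inj] by blast
  have op: "open (g ` unit_disc)" by (rule open_mapping_thm3[OF hol open_ball inj])
  have dQ: "((\<lambda>w. F (j w)) has_field_derivative deriv F z / deriv g z) (at (g z))" if z: "z \<in> unit_disc" for z
  proof -
    have 1: "(j has_field_derivative deriv j (g z)) (at (g z))"
      by (rule holomorphic_derivI[OF j(1) op]) (use z in auto)
    have 2: "(F has_field_derivative deriv F z) (at (j (g z)))"
      using holomorphic_derivI[OF F, of z] z j(3) by auto
    have "((\<lambda>w. F (j w)) has_field_derivative deriv F z * deriv j (g z)) (at (g z))"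
      using DERIV_chain[OF 2 1] by (simp add: o_def)
    moreover have "deriv F z * deriv j (g z) = deriv F z / deriv g z"
      using j(2)[OF z] by (auto simp: divide_simps mult_ac)
    ultimately show ?thesis by simp
  qed
  define A B where "A = g a" and "B = g b"
  have AB: "B - A \<noteq> 0" using inj ab by (auto simp: A_def B_def inj_on_def)
  define \<gamma> where "\<gamma> t = A + of_real t * (B - A)" for t :: real
  have \<gamma>: "(\<gamma> has_vector_derivative (B - A)) (at t)" for t
    unfolding \<gamma>_def by (auto intro!: derivative_eq_intros)
  have \<gamma>_in: "\<gamma> t \<in> g ` unit_disc" if "0 \<le> t" "t \<le> 1" for t
  proof -
    have "(1 - t) *\<^sub>R A + t *\<^sub>R B \<in> g ` unit_disc"
      by (rule convexD_alt[OF convex_function_image[OF g]]) (use ab that in \<open>auto simp: A_def B_def\<close>)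
    moreover have "(1 - t) *\<^sub>R A + t *\<^sub>R B = \<gamma> t"
      by (simp add: \<gamma>_def scaleR_conv_of_real algebra_simps)
    ultimately show ?thesis by simp
  qed
  \<comment> \<open>dividing by the direction of the segment makes the derivative exactly \<open>Re (F'/g')\<close>\<close>
  define \<Phi> where "\<Phi> t = Re (1 / (B - A) * F (j (\<gamma> t)))" for t
  have "\<Phi> 0 < \<Phi> 1"
  proof (rule DERIV_pos_imp_increasing[of 0 1 \<Phi>])
    fix t :: real assume t: "0 \<le> t" "t \<le> 1"
    obtain z where z: "z \<in> unit_disc" "\<gamma> t = g z" using \<gamma>_in[OF t] by auto
    have "(\<Phi> has_real_derivative Re (1 / (B - A) * (deriv F z / deriv g z) * (B - A))) (at t)"
      unfolding \<Phi>_def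
      by (rule has_real_derivative_Re_along_path[OF \<gamma>, where F = "\<lambda>w. F (j w)"]) (use dQ[OF z(1)] z in simp)
    moreover have "1 / (B - A) * (deriv F z / deriv g z) * (B - A) = deriv F z / deriv g z" using AB by simp
    ultimately show "\<exists>y. (\<Phi> has_real_derivative y) (at t) \<and> 0 < y" using pos[OF z(1)] by auto
  qed simp
  then show ?thesis using ab j(3)
    by (simp add: \<Phi>_def \<gamma>_def A_def B_def diff_divide_distrib)
qed

text \<open>
  The map \<open>z \<mapsto> G\<^sup>-\<^sup>1 (c G z)\<close> is a Schwarz function, because the image is starlike.
\<close>
section \<open>Starlike functions\<close>

lemma starlike_contraction:
  assumes G: "G holomorphic_on unit_disc" "inj_on G unit_disc" "G 0 = 0"
    and star: "starlike_wrt 0 (G ` unit_disc)"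
    and c: "0 \<le> c" "c \<le> 1" and z: "z \<in> unit_disc"
  shows "\<exists>w. norm w \<le> norm z \<and> G w = of_real c * G z"
proof -
  obtain j where j: "j holomorphic_on G ` unit_disc" "\<And>z. z \<in> unit_disc \<Longrightarrow> j (G z) = z"
    using holomorphic_has_inverse[OF G(1) open_ball G(2)] by metis
  have scaled: "of_real c * G x \<in> G ` unit_disc" if "x \<in> unit_disc" for x
  proof -
    have "closed_segment 0 (G x) \<subseteq> G ` unit_disc" using star that by (auto simp: starlike_wrt_def)
    moreover have "of_real c * G x \<in> closed_segment 0 (G x)"
      using c by (auto simp: closed_segment_def scaleR_conv_of_real)
    ultimately show ?thesis by blast
  qed
  define \<omega> where "\<omega> x = j (of_real c * G x)" for x
  have G\<omega>: "\<omega> x \<in> unit_disc \<and> G (\<omega> x) = of_real c * G x" if x: "x \<in> unit_disc" for x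
    using scaled[OF x] j(2) by (auto simp: \<omega>_def)
  have "norm (\<omega> z) \<le> norm z"
  proof (rule Schwarz_Lemma(1))
    have "(\<lambda>x. of_real c * G x) holomorphic_on unit_disc" by (intro holomorphic_intros G)
    then show "\<omega> holomorphic_on unit_disc" unfolding \<omega>_def
      by (rule holomorphic_on_compose_gen[OF _ j(1), unfolded o_def]) (use scaled in blast)
    show "\<omega> 0 = 0" using j(2)[of 0] by (simp add: \<omega>_def G)
    show "norm (\<omega> x) < 1" if "norm x < 1" for x using G\<omega>[of x] that by simp
  qed (use z in simp)
  with G\<omega>[OF z] show ?thesis by blast
qed

text \<open>
  Alexander's theorem. Since \<open>\<omega>\<^sub>c z = G\<^sup>-\<^sup>1 (c G z)\<close> does not increase the modulus and is the identity for
  \<open>c = 1\<close>, the derivative in \<open>c\<close> at 1 gives \<open>Re (G / (z G')) \<ge> 0\<close> for \<open>G = z H'\<close>; and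
  \<open>z G' / G = 1 + z H'' / H'\<close>.
\<close>
lemma convex_of_starlike:
  assumes H: "H holomorphic_on unit_disc"
    and inj: "inj_on (\<lambda>z. z * deriv H z) unit_disc"
    and star: "starlike_wrt 0 ((\<lambda>z. z * deriv H z) ` unit_disc)"
  shows "convex_function H"
proof -
  define G where "G = (\<lambda>z. z * deriv H z)"
  have H': "deriv H holomorphic_on unit_disc" by (intro holomorphic_deriv H) auto
  have G: "G holomorphic_on unit_disc" unfolding G_def by (intro holomorphic_intros H')
  have G0: "G 0 = 0" by (simp add: G_def)
  note G_inj = inj[folded G_def] and G_star = star[folded G_def]
  have dG: "deriv G z = deriv H z + z * deriv (deriv H) z" if "z \<in> unit_disc" for z
  proof -
    have 1: "(deriv H has_field_derivative deriv (deriv H) z) (at z)"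
      using holomorphic_derivI[OF H' _ that] by auto
    have "(G has_field_derivative deriv H z + z * deriv (deriv H) z) (at z)"
      unfolding G_def by (rule derivative_eq_intros 1 refl)+ (simp add: algebra_simps)
    then show ?thesis by (rule DERIV_imp_deriv)
  qed
  have G'nz: "deriv G z \<noteq> 0" if "z \<in> unit_disc" for z
    by (rule holomorphic_injective_imp_regular[OF G open_ball G_inj that])
  have nz: "deriv H z \<noteq> 0" if z: "z \<in> unit_disc" for z
  proof (cases "z = 0")
    case True
    then show ?thesis using G'nz[of 0] dG[of 0] by simp
  next
    case False
    then have "G z \<noteq> G 0" using G_inj z by (auto simp: inj_on_def)
    then show ?thesis by (auto simp: G_def)
  qed
  define u where "u z = 1 + z * deriv (deriv H) z / deriv H z" for z
  have u_eq: "u z = deriv G z / deriv H z" if "z \<in> unit_disc" for z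
    using nz[OF that] dG[OF that] by (simp add: u_def field_simps)
  obtain j where j: "j holomorphic_on G ` unit_disc"
      "\<And>z. z \<in> unit_disc \<Longrightarrow> deriv G z * deriv j (G z) = 1"
      "\<And>z. z \<in> unit_disc \<Longrightarrow> j (G z) = z"
    using holomorphic_has_inverse[OF G open_ball G_inj] by blast
  have op: "open (G ` unit_disc)" by (rule open_mapping_thm3[OF G open_ball G_inj])
  have nonneg: "0 \<le> Re (u z)" if z: "z \<in> unit_disc" for z
  proof (cases "z = 0")
    case True
    then show ?thesis by (simp add: u_def)
  next
    case False
    define e where "e c = Re (cnj z * j (of_real c * G z))" for c :: real
    have "((\<lambda>c. of_real c * G z) has_vector_derivative G z) (at 1)"
      by (auto intro!: derivative_eq_intros)
    moreover have "(j has_field_derivative deriv j (G z)) (at (of_real 1 * G z))"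
      using holomorphic_derivI[OF j(1) op, of "G z"] z by auto
    ultimately have e': "(e has_real_derivative Re (cnj z * deriv j (G z) * G z)) (at 1)"
      unfolding e_def by (rule has_real_derivative_Re_along_path)
    have e_le: "e c \<le> e 1" if c: "0 \<le> c" "c \<le> 1" for c
    proof -
      obtain w where w: "norm w \<le> norm z" "G w = of_real c * G z"
        using starlike_contraction[OF G G_inj G0 G_star c z] by blast
      then have "j (of_real c * G z) = w" using j(3)[of w] z by simp
      then have "e c \<le> norm (cnj z * w)" unfolding e_def by (metis complex_Re_le_cmod)
      also have "\<dots> \<le> norm z * norm z" using w by (simp add: norm_mult mult_left_mono)
      also have "\<dots> = e 1" using j(3)[OF z] unfolding e_def
        by (simp add: cmod_power2[symmetric] flip: power2_eq_square)
      finally show ?thesis .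
    qed
    have "0 \<le> Re (cnj z * deriv j (G z) * G z)"
    proof (rule ccontr)
      assume "\<not> ?thesis"
      then obtain d where d: "d > 0" "\<And>h. 0 < h \<Longrightarrow> h < d \<Longrightarrow> e 1 < e (1 - h)"
        using DERIV_neg_dec_left[OF e'] by auto
      have "e 1 < e (1 - min (d / 2) 1)" using d by (intro d(2)) auto
      moreover have "e (1 - min (d / 2) 1) \<le> e 1" using d by (intro e_le) auto
      ultimately show False by simp
    qed
    also have "cnj z * deriv j (G z) * G z = of_real ((norm z)\<^sup>2) / u z"
    proof -
      have "deriv j (G z) = 1 / deriv G z"
        using j(2)[OF z] G'nz[OF z] by (simp add: eq_divide_eq mult.commute)
      then show ?thesis using G'nz[OF z] nz[OF z] unfolding u_eq[OF z]
        by (simp add: G_def complex_norm_square field_simps del: of_real_power)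
    qed
    also have "Re \<dots> = (norm z)\<^sup>2 * Re (u z) / (norm (u z))\<^sup>2"
      by (simp add: Re_divide flip: cmod_power2)
    finally have "0 \<le> (norm z)\<^sup>2 * Re (u z) / (norm (u z))\<^sup>2" .
    moreover have "u z \<noteq> 0" using u_eq[OF z] G'nz[OF z] nz[OF z] by simp
    ultimately show ?thesis using False by (simp add: zero_le_divide_iff zero_le_mult_iff)
  qed
  have "0 < Re (u z)" if "z \<in> unit_disc" for z
  proof (rule Re_pos_of_nonneg[OF _ nonneg _ that])
    show "u holomorphic_on unit_disc" unfolding u_def
      using nz by (intro holomorphic_intros holomorphic_deriv H' H) auto
  qed (auto simp: u_def)
  then show ?thesis using nz H by (simp add: convex_function_def u_def)
qed

text \<open>
  Let \<open>|z| \<le> \<rho> < \<sigma> < 1\<close>. Suppose that \<open>h\<close> maps some point of the closed \<open>\<rho>\<close>-disc outside the image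
  under \<open>H\<close> of the open \<open>\<sigma>\<close>-disc, and take such a point \<open>z\<^sub>0\<close> of smallest modulus. Among the points of
  modulus at most \<open>|z\<^sub>0|\<close> the function \<open>\<Omega> = H\<^sup>-\<^sup>1 \<circ> h\<close> has its largest modulus \<open>\<sigma>\<close> at \<open>z\<^sub>0\<close>, so by Jack's lemma
  \<open>z\<^sub>0 \<Omega>'(z\<^sub>0) = m \<zeta>\<close> with \<open>\<zeta> = \<Omega>(z\<^sub>0)\<close> and \<open>m \<ge> 1\<close>, which means \<open>G (\<omega> z\<^sub>0) = m G \<zeta>\<close> for \<open>G = z H'\<close>. Starlikeness
  of \<open>G\<close> turns this into \<open>G \<zeta> = G w\<close> with \<open>|w| \<le> |z\<^sub>0| < |\<zeta>|\<close>.
\<close>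
section \<open>Subordination to a convex function\<close>

lemma suffridge_image:
  assumes H: "convex_function H" "H 0 = 0"
    and inj: "inj_on (\<lambda>z. z * deriv H z) unit_disc"
    and star: "starlike_wrt 0 ((\<lambda>z. z * deriv H z) ` unit_disc)"
    and h: "h holomorphic_on unit_disc" "h 0 = 0"
    and \<omega>: "\<omega> holomorphic_on unit_disc" "\<omega> ` unit_disc \<subseteq> unit_disc" "\<omega> 0 = 0"
    and eq: "\<And>z. z \<in> unit_disc \<Longrightarrow> z * deriv h z = \<omega> z * deriv H (\<omega> z)"
    and z: "z \<in> unit_disc"
  shows "h z \<in> H ` unit_disc"
proof -
  define G where "G = (\<lambda>z. z * deriv H z)"
  note G_inj = inj[folded G_def] and G_star = star[folded G_def]
  have H_hol: "H holomorphic_on unit_disc" using H by (simp add: convex_function_def)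
  have G_hol: "G holomorphic_on unit_disc" "G 0 = 0"
    unfolding G_def by (auto intro!: holomorphic_intros holomorphic_deriv H_hol)
  note H_inj = convex_function_inj_on[OF H(1)]
  obtain j where j: "j holomorphic_on H ` unit_disc" "\<And>z. z \<in> unit_disc \<Longrightarrow> j (H z) = z"
    using holomorphic_has_inverse[OF H_hol open_ball H_inj] by metis
  have opH: "open (H ` unit_disc)" by (rule open_mapping_thm3[OF H_hol open_ball H_inj])
  obtain \<rho> where \<rho>: "norm z < \<rho>" "\<rho> < 1" using z dense[of "norm z" 1] by auto
  \<comment> \<open>the strict gap between the radii \<open>\<rho>\<close> and \<open>\<sigma>\<close> produces the contradiction, because \<open>m = 1\<close> is possible below;
    \<open>\<sigma> < 1\<close> keeps everything away from the boundary of the unit disc\<close>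
  obtain \<sigma> where \<sigma>: "\<rho> < \<sigma>" "\<sigma> < 1" using \<rho>(2) dense by blast
  have \<sigma>0: "0 < \<sigma>" "0 < \<rho>" using \<rho> \<sigma> norm_ge_zero[of z] by linarith+
  have op: "open (H ` ball 0 \<sigma>)"
    using \<sigma> by (intro open_mapping_thm3 holomorphic_on_subset[OF H_hol] inj_on_subset[OF H_inj]) auto
  have cl: "closed (H ` cball 0 \<sigma>)"
    using \<sigma> by (intro compact_imp_closed compact_continuous_image holomorphic_on_imp_continuous_on
        holomorphic_on_subset[OF H_hol]) auto
  have cont_h: "continuous_on (cball 0 \<rho>) h"
    using \<rho> by (intro holomorphic_on_imp_continuous_on holomorphic_on_subset[OF h(1)]) auto
  define Bad where "Bad = {x \<in> cball 0 \<rho>. h x \<in> - (H ` ball 0 \<sigma>)}"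
  have "Bad = {}"
  proof (rule ccontr)
    assume "Bad \<noteq> {}"
    moreover have "compact Bad"
    proof -
      have "closed Bad" unfolding Bad_def
        using continuous_closed_preimage[OF cont_h, of "- (H ` ball 0 \<sigma>)"] op
        by (auto simp: vimage_def Int_def closed_Compl)
      moreover have "bounded Bad" by (rule bounded_subset[OF bounded_cball[of 0 \<rho>]]) (auto simp: Bad_def)
      ultimately show ?thesis by (simp add: compact_eq_bounded_closed)
    qed
    ultimately obtain z0 where z0: "z0 \<in> Bad" and min: "\<And>x. x \<in> Bad \<Longrightarrow> norm z0 \<le> norm x"
      using continuous_attains_inf[of Bad norm] continuous_on_norm_id by blast
    define R where "R = norm z0"
    have R\<rho>: "R \<le> \<rho>" using z0 by (simp add: Bad_def R_def)
    have z0D: "z0 \<in> unit_disc" using z0 \<rho> by (auto simp: Bad_def)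
    have "0 \<notin> Bad" using H(2) h(2) \<sigma>0 by (force simp: Bad_def)
    then have R0: "0 < R" using z0 by (auto simp: R_def)
    have inside: "h x \<in> H ` ball 0 \<sigma>" if "norm x < R" for x
      using min[of x] that R\<rho> by (auto simp: Bad_def R_def)
    have "h ` closure (ball 0 R) \<subseteq> H ` cball 0 \<sigma>"
    proof (rule image_closure_subset[OF _ cl])
      show "continuous_on (closure (ball 0 R)) h"
        using R0 R\<rho> by (intro continuous_on_subset[OF cont_h]) auto
      show "h ` ball 0 R \<subseteq> H ` cball 0 \<sigma>" using inside by force
    qed
    then have inside_le: "h x \<in> H ` cball 0 \<sigma>" if "norm x \<le> R" for x
      using R0 that by (auto simp: image_subset_iff)
    obtain \<zeta> where \<zeta>: "norm \<zeta> \<le> \<sigma>" "h z0 = H \<zeta>" using inside_le[of z0] by (auto simp: R_def)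
    have "norm \<zeta> = \<sigma>"
    proof (rule ccontr)
      assume "norm \<zeta> \<noteq> \<sigma>"
      then have "h z0 \<in> H ` ball 0 \<sigma>" using \<zeta> by auto
      then show False using z0 by (simp add: Bad_def)
    qed
    define \<Omega> where "\<Omega> x = j (h x)" for x
    have \<zeta>D: "\<zeta> \<in> unit_disc" using \<zeta> \<sigma> by simp
    have \<Omega>z0: "\<Omega> z0 = \<zeta>" using \<zeta> \<zeta>D j(2) by (simp add: \<Omega>_def)
    have \<Omega>_le: "norm (\<Omega> x) \<le> \<sigma>" if x: "norm x \<le> R" for x
    proof -
      obtain y where y: "norm y \<le> \<sigma>" "h x = H y" using inside_le[OF x] by auto
      then have "\<Omega> x = y" using j(2)[of y] \<sigma> by (simp add: \<Omega>_def)
      then show ?thesis using y by simp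
    qed
    have \<Omega>_less: "norm (\<Omega> x) < \<sigma>" if x: "norm x < R" for x
    proof -
      obtain y where y: "norm y < \<sigma>" "h x = H y" using inside[OF x] by auto
      then have "\<Omega> x = y" using j(2)[of y] \<sigma> by (simp add: \<Omega>_def)
      then show ?thesis using y by simp
    qed
    have schwarz: "norm (\<Omega> (of_real t * z0)) \<le> \<sigma> * t" if t: "0 \<le> t" "t < 1" for t
    proof -
      define S where "S x = \<Omega> (of_real R * x) / of_real \<sigma>" for x
      have "norm (S (of_real t * z0 / of_real R)) \<le> norm (of_real t * z0 / of_real R)"
      proof (rule Schwarz_Lemma(1))
        have "(\<lambda>x. h (of_real R * x)) holomorphic_on unit_disc"
          by (rule holomorphic_on_compose_gen[OF _ h(1), unfolded o_def])
            (use R0 R\<rho> \<rho> in \<open>auto intro!: holomorphic_intros simp: norm_mult mult_le_one le_less_trans[OF mult_right_le_one_le]\<close>)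
        then have "(\<lambda>x. j (h (of_real R * x))) holomorphic_on unit_disc"
        proof (rule holomorphic_on_compose_gen[OF _ j(1), unfolded o_def])
          show "(\<lambda>x. h (of_real R * x)) ` unit_disc \<subseteq> H ` unit_disc"
          proof (rule image_subsetI)
            fix x :: complex assume "x \<in> unit_disc"
            then have "h (of_real R * x) \<in> H ` ball 0 \<sigma>" using R0 by (intro inside) (simp add: norm_mult)
            then show "h (of_real R * x) \<in> H ` unit_disc" using \<sigma> by auto
          qed
        qed
        then show "S holomorphic_on unit_disc" unfolding S_def \<Omega>_def
          using \<sigma>0 by (intro holomorphic_intros) auto
        show "S 0 = 0" using j(2)[of 0] H(2) h(2) by (simp add: S_def \<Omega>_def)
        show "norm (S x) < 1" if "norm x < 1" for x
          using \<Omega>_less[of "of_real R * x"] that R0 \<sigma>0 by (simp add: S_def norm_mult norm_divide)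
        show "norm (of_real t * z0 / of_real R) < 1"
          using t R0 by (simp add: norm_mult norm_divide R_def)
      qed
      then show ?thesis using R0 \<sigma>0 t
        by (simp add: S_def norm_mult norm_divide R_def[symmetric] field_simps)
    qed
    define D where "D = deriv h z0 / deriv H \<zeta>"
    have dj: "(j has_field_derivative 1 / deriv H \<zeta>) (at (H \<zeta>))"
    proof -
      have 1: "(H has_field_derivative deriv H \<zeta>) (at \<zeta>)"
        by (rule holomorphic_derivI[OF H_hol open_ball \<zeta>D])
      have 2: "(j has_field_derivative deriv j (H \<zeta>)) (at (H \<zeta>))"
        by (rule holomorphic_derivI[OF j(1) opH]) (use \<zeta>D in auto)
      have "((\<lambda>x. j (H x)) has_field_derivative deriv j (H \<zeta>) * deriv H \<zeta>) (at \<zeta>)"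
        using DERIV_chain[OF 2 1] by (simp add: o_def)
      moreover have "((\<lambda>x. j (H x)) has_field_derivative 1) (at \<zeta>)"
        by (rule has_field_derivative_transform_within_open[OF DERIV_ident open_ball \<zeta>D])
          (use j(2) in auto)
      ultimately have "deriv j (H \<zeta>) * deriv H \<zeta> = 1" by (rule DERIV_unique)
      moreover have "deriv H \<zeta> \<noteq> 0" using H(1) \<zeta>D by (simp add: convex_function_def)
      ultimately have "deriv j (H \<zeta>) = 1 / deriv H \<zeta>" by (simp add: eq_divide_eq)
      with 2 show ?thesis by simp
    qed
    have d\<Omega>: "(\<Omega> has_field_derivative D) (at z0)"
    proof -
      have 1: "(h has_field_derivative deriv h z0) (at z0)"
        by (rule holomorphic_derivI[OF h(1) open_ball z0D])
      have 2: "(j has_field_derivative 1 / deriv H \<zeta>) (at (h z0))" using dj \<zeta>(2) by simp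
      show ?thesis using DERIV_chain[OF 2 1] by (simp add: \<Omega>_def[abs_def] o_def D_def)
    qed
    \<comment> \<open>radial half of Jack's lemma: by the Schwarz lemma \<open>|\<Omega> (t z\<^sub>0)| \<le> \<sigma> t\<close>, with equality at \<open>t = 1\<close>\<close>
    have radial: "\<sigma>\<^sup>2 \<le> Re (cnj \<zeta> * D * z0)"
    proof -
      define e where "e t = Re (cnj \<zeta> * \<Omega> (of_real t * z0)) - \<sigma>\<^sup>2 * t" for t :: real
      have "((\<lambda>t. of_real t * z0) has_vector_derivative z0) (at 1)"
        by (auto intro!: derivative_eq_intros)
      moreover have "(\<Omega> has_field_derivative D) (at (of_real 1 * z0))" using d\<Omega> by simp
      ultimately have 1: "((\<lambda>t. Re (cnj \<zeta> * \<Omega> (of_real t * z0))) has_real_derivative Re (cnj \<zeta> * D * z0)) (at 1)"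
        by (rule has_real_derivative_Re_along_path)
      have e': "(e has_real_derivative Re (cnj \<zeta> * D * z0) - \<sigma>\<^sup>2) (at 1)"
        unfolding e_def by (rule DERIV_diff[OF 1]) (auto intro!: derivative_eq_intros)
      have "cnj \<zeta> * \<zeta> = of_real (\<sigma>\<^sup>2)"
        using \<open>norm \<zeta> = \<sigma>\<close> complex_norm_square[of \<zeta>] by (simp add: mult.commute)
      then have e1: "e 1 = 0" by (simp add: e_def \<Omega>z0 del: of_real_power)
      have e_le: "e t \<le> 0" if t: "0 \<le> t" "t < 1" for t
      proof -
        have "Re (cnj \<zeta> * \<Omega> (of_real t * z0)) \<le> norm (cnj \<zeta> * \<Omega> (of_real t * z0))"
          by (rule complex_Re_le_cmod)
        also have "\<dots> \<le> \<sigma> * (\<sigma> * t)"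
          using schwarz[OF t] \<open>norm \<zeta> = \<sigma>\<close> \<sigma>0 by (simp add: norm_mult)
        finally show ?thesis by (simp add: e_def power2_eq_square mult_ac)
      qed
      show ?thesis
      proof (rule ccontr)
        assume "\<not> ?thesis"
        then obtain d where d: "d > 0" "\<And>h. 0 < h \<Longrightarrow> h < d \<Longrightarrow> e 1 < e (1 - h)"
          using DERIV_neg_dec_left[OF e'] by auto
        have "e 1 < e (1 - min (d / 2) 1)" using d by (intro d(2)) auto
        moreover have "e (1 - min (d / 2) 1) \<le> 0" using d by (intro e_le) auto
        ultimately show False using e1 by simp
      qed
    qed
    \<comment> \<open>angular half: on the circle \<open>|\<Omega>|\<close> is maximal at \<open>z\<^sub>0\<close>\<close>
    have angular: "Re (cnj \<zeta> * D * (\<i> * z0)) = 0"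
    proof -
      define e where "e s = Re (cnj \<zeta> * \<Omega> (z0 * cis s))" for s
      have "((\<lambda>s. z0 * cis s) has_vector_derivative \<i> * (z0 * cis 0)) (at 0)"
        by (rule cis_path_has_vector_derivative)
      moreover have "(\<Omega> has_field_derivative D) (at (z0 * cis 0))" using d\<Omega> by simp
      ultimately have e': "(e has_real_derivative Re (cnj \<zeta> * D * (\<i> * (z0 * cis 0)))) (at 0)"
        unfolding e_def by (rule has_real_derivative_Re_along_path)
      have "e s \<le> e 0" for s
      proof -
        have "e s \<le> norm (cnj \<zeta> * \<Omega> (z0 * cis s))" unfolding e_def by (rule complex_Re_le_cmod)
        also have "\<dots> \<le> \<sigma> * \<sigma>"
          using \<Omega>_le[of "z0 * cis s"] \<open>norm \<zeta> = \<sigma>\<close> \<sigma>0 by (simp add: norm_mult R_def)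
        also have "\<dots> = Re (\<zeta> * cnj \<zeta>)"
          using complex_norm_square[of \<zeta>] \<open>norm \<zeta> = \<sigma>\<close>
          by (metis Re_complex_of_real of_real_power power2_eq_square)
        also have "\<dots> = e 0" by (simp add: e_def \<Omega>z0 mult.commute)
        finally show ?thesis .
      qed
      then show ?thesis using DERIV_local_max[OF e', of 1] by simp
    qed
    define m where "m = Re (cnj \<zeta> * D * z0) / \<sigma>\<^sup>2"
    have m1: "1 \<le> m" using radial \<sigma>0 by (simp add: m_def)
    have "Im (cnj \<zeta> * D * z0) = 0" using angular by (simp add: algebra_simps)
    then have "cnj \<zeta> * (D * z0) = of_real (m * \<sigma>\<^sup>2)"
      using \<sigma>0 by (simp add: m_def complex_eq_iff mult.assoc)
    then have "\<zeta> * cnj \<zeta> * (D * z0) = of_real m * \<zeta> * of_real (\<sigma>\<^sup>2)" by (simp add: mult_ac)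
    moreover have "\<zeta> \<noteq> 0" using \<open>norm \<zeta> = \<sigma>\<close> \<sigma>0 by auto
    ultimately have "D * z0 = of_real m * \<zeta>"
      using complex_norm_square[of \<zeta>] \<open>norm \<zeta> = \<sigma>\<close> \<sigma>0 by (simp add: mult_ac)
    moreover have "deriv h z0 = D * deriv H \<zeta>"
      using H(1) \<zeta>D by (simp add: D_def convex_function_def)
    ultimately have "z0 * deriv h z0 = of_real m * G \<zeta>" by (simp add: G_def mult_ac)
    then have "G (\<omega> z0) = of_real m * G \<zeta>" using eq[OF z0D] by (simp add: G_def)
    then have G\<zeta>: "G \<zeta> = of_real (1 / m) * G (\<omega> z0)" using m1 by simp
    have \<omega>z0: "\<omega> z0 \<in> unit_disc" using \<omega>(2) z0D by blast
    obtain w where w: "norm w \<le> norm (\<omega> z0)" "G w = of_real (1 / m) * G (\<omega> z0)"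
      using starlike_contraction[OF G_hol(1) G_inj G_hol(2) G_star _ _ \<omega>z0, of "1 / m"] m1 by auto
    have "norm (\<omega> z0) \<le> norm z0"
      using Schwarz_Lemma(1)[OF \<omega>(1,3), of z0] \<omega>(2) z0D by (auto simp: image_subset_iff)
    then have "norm w < \<sigma>" using w R\<rho> \<sigma> by (simp add: R_def)
    moreover have "w = \<zeta>"
      using G_inj w(2) G\<zeta> \<zeta>D \<open>norm w < \<sigma>\<close> \<sigma> by (auto simp: inj_on_def)
    ultimately show False using \<open>norm \<zeta> = \<sigma>\<close> by simp
  qed
  then have "h z \<in> H ` ball 0 \<sigma>" using \<rho> by (auto simp: Bad_def)
  then show ?thesis using \<sigma> by auto
qed

lemma subordinate_of_image:
  assumes H: "H holomorphic_on unit_disc" "inj_on H unit_disc" "H 0 = p 0"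
    and p: "p holomorphic_on unit_disc" "p ` unit_disc \<subseteq> H ` unit_disc"
  shows "subordinate p H"
proof -
  obtain j where j: "j holomorphic_on H ` unit_disc" "\<And>z. z \<in> unit_disc \<Longrightarrow> j (H z) = z"
    using holomorphic_has_inverse[OF H(1) open_ball H(2)] by metis
  show ?thesis unfolding subordinate_def
  proof (intro exI[of _ "\<lambda>z. j (p z)"] conjI ballI)
    show "(\<lambda>z. j (p z)) holomorphic_on unit_disc"
      by (rule holomorphic_on_compose_gen[OF p(1) j(1) p(2), unfolded o_def])
    show "(\<lambda>z. j (p z)) ` unit_disc \<subseteq> unit_disc" using p(2) j(2) by force
    show "j (p 0) = 0" using j(2)[of 0] H(3) by simp
    show "p z = H (j (p z))" if "z \<in> unit_disc" for z using p(2) j(2) that by force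
  qed
qed

text \<open>
  Take \<open>z\<^sub>0\<close> on the circle with \<open>|F(z\<^sub>0)|\<close> minimal. The segment from 0 to \<open>F(z\<^sub>0)\<close> lies in the image, and its
  preimage is a path from 0 to \<open>z\<^sub>0\<close> along which the modulus grows at speed at most \<open>|F(z\<^sub>0)| / |F'|\<close>. So
  \<open>P\<close> of the modulus grows at speed at most \<open>|F(z\<^sub>0)|\<close>.
\<close>
section \<open>Growth and covering for univalent functions\<close>

lemma univalent_growth:
  assumes F: "F holomorphic_on unit_disc" "inj_on F unit_disc" "F 0 = 0"
    and P: "\<And>t. 0 \<le> t \<Longrightarrow> t < 1 \<Longrightarrow> (P has_real_derivative L t) (at t)" "P 0 = 0"
    and L: "\<And>z. z \<in> unit_disc \<Longrightarrow> L (norm z) \<le> norm (deriv F z)" "\<And>t. 0 \<le> t \<Longrightarrow> t < 1 \<Longrightarrow> 0 \<le> L t"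
    and z: "z \<in> unit_disc"
  shows "P (norm z) \<le> norm (F z)"
proof (cases "z = 0")
  case True
  then show ?thesis using P(2) by simp
next
  case False
  define r where "r = norm z"
  have r: "0 < r" "r < 1" using False z by (auto simp: r_def)
  obtain j where j: "j holomorphic_on F ` unit_disc"
      "\<And>z. z \<in> unit_disc \<Longrightarrow> deriv F z * deriv j (F z) = 1"
      "\<And>z. z \<in> unit_disc \<Longrightarrow> j (F z) = z"
    using holomorphic_has_inverse[OF F(1) open_ball F(2)] by blast
  have opF: "open (F ` unit_disc)" by (rule open_mapping_thm3[OF F(1) open_ball F(2)])
  have contF: "continuous_on (cball 0 r) F"
    using r by (intro holomorphic_on_imp_continuous_on holomorphic_on_subset[OF F(1)]) auto
  obtain z0 where z0: "z0 \<in> sphere 0 r" and min: "\<And>x. x \<in> sphere 0 r \<Longrightarrow> norm (F z0) \<le> norm (F x)"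
  proof -
    have "continuous_on (sphere 0 r) (\<lambda>x. norm (F x))"
      by (intro continuous_on_norm continuous_on_subset[OF contF]) auto
    then show ?thesis
      using continuous_attains_inf[of "sphere 0 r" "\<lambda>x. norm (F x)"] that r by auto
  qed
  define m where "m = norm (F z0)"
  have z0D: "z0 \<in> unit_disc" using z0 r by simp
  have m0: "0 < m" using F z0 z0D r unfolding m_def inj_on_def
    by (metis centre_in_ball mem_sphere_0 norm_eq_zero not_less_iff_gr_or_eq zero_less_norm_iff zero_less_one)
  have covers: "ball 0 m \<subseteq> F ` cball 0 r"
  proof -
    have "ball (F 0) m \<subseteq> F ` cball 0 r"
    proof (rule ball_subset_open_map_image)
      show "open (F ` interior (cball 0 r))"
        using r by (intro open_mapping_thm3 holomorphic_on_subset[OF F(1)] inj_on_subset[OF F(2)]) auto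
      show "m \<le> norm (F x - F 0)" if "x \<in> frontier (cball 0 r)" for x
        using that min[of x] F(3) r by (simp add: m_def)
    qed (use r m0 contF in auto)
    then show ?thesis using F(3) by simp
  qed
  define w where "w s = of_real s * F z0" for s :: real
  have w_ex: "\<exists>x\<in>unit_disc. w s = F x" if "0 \<le> s" "s \<le> 1" for s
  proof (cases "s = 1")
    case True
    then show ?thesis using z0D by (auto simp: w_def)
  next
    case False
    then have "w s \<in> ball 0 m" using that m0 by (simp add: w_def norm_mult m_def)
    then have "w s \<in> F ` cball 0 r" using covers by blast
    then show ?thesis using r by force
  qed
  define x where "x s = j (w s)" for s
  have x: "x s \<in> unit_disc" "F (x s) = w s" if "0 \<le> s" "s \<le> 1" for s
    using w_ex[OF that] j(3) by (auto simp: x_def)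
  have x0: "x 0 = 0" using j(3)[of 0] F(3) by (simp add: x_def w_def)
  have x1: "x 1 = z0" using j(3)[OF z0D] by (simp add: x_def w_def)
  have x_der: "(x has_vector_derivative F z0 * (1 / deriv F (x s))) (at s)" if s: "0 \<le> s" "s \<le> 1" for s
  proof -
    have 1: "(w has_vector_derivative F z0) (at s)"
      unfolding w_def by (auto intro!: derivative_eq_intros)
    have "(j has_field_derivative deriv j (w s)) (at (w s))"
      by (rule holomorphic_derivI[OF j(1) opF]) (use x[OF s] in \<open>metis imageI\<close>)
    moreover have "deriv j (w s) = 1 / deriv F (x s)"
      using j(2)[OF x(1)[OF s]] x(2)[OF s] by (metis mult.commute mult_zero_right nonzero_eq_divide_eq zero_neq_one)
    ultimately have 2: "(j has_field_derivative 1 / deriv F (x s)) (at (w s))" by simp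
    show ?thesis using field_vector_diff_chain_at[OF 1 2] by (simp add: x_def[abs_def] o_def)
  qed
  have x_nz: "x s \<noteq> 0" if "0 < s" "s \<le> 1" for s
    using x(2)[of s] that m0 F(3) by (auto simp: w_def m_def)
  have F'nz: "deriv F y \<noteq> 0" if "y \<in> unit_disc" for y
    by (rule holomorphic_injective_imp_regular[OF F(1) open_ball F(2) that])
  have P_cont: "continuous_on {0..<1} P"
    by (rule DERIV_continuous_on) (use P(1) in \<open>auto intro: DERIV_subset\<close>)
  have x_cont: "continuous_on {0..1} x"
    by (rule continuous_at_imp_continuous_on) (use has_vector_derivative_continuous[OF x_der] in auto)
  \<comment> \<open>nonincreasing on \<open>[0, 1]\<close>; its end values give the claim\<close>
  define \<Psi> where "\<Psi> s = P (norm (x s)) - m * s" for s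
  have "\<Psi> 1 \<le> \<Psi> 0"
  proof (rule DERIV_nonpos_imp_decreasing_open[of 0 1 \<Psi>])
    show "continuous_on {0..1} \<Psi>" unfolding \<Psi>_def
      by (intro continuous_intros continuous_on_compose2[OF P_cont] x_cont) (use x in auto)
    fix s :: real assume s: "0 < s" "s < 1"
    have xs: "x s \<in> unit_disc" "x s \<noteq> 0" using x(1)[of s] x_nz[of s] s by auto
    define v where "v = F z0 * (1 / deriv F (x s))"
    have x': "(x has_derivative (\<lambda>h. h *\<^sub>R v)) (at s)"
      using x_der[of s] s by (simp add: v_def has_vector_derivative_def)
    have "((\<lambda>s. norm (x s)) has_derivative (\<lambda>h. (h *\<^sub>R v) \<bullet> sgn (x s))) (at s)"
      using diff_chain_at[OF x' has_derivative_norm[OF xs(2)]] by (simp add: o_def)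
    then have "((\<lambda>s. norm (x s)) has_real_derivative v \<bullet> sgn (x s)) (at s)"
      by (simp add: has_field_derivative_def mult_commute_abs)
    then have "((\<lambda>s. P (norm (x s))) has_real_derivative L (norm (x s)) * (v \<bullet> sgn (x s))) (at s)"
      using DERIV_chain2[of P "L (norm (x s))" "\<lambda>s. norm (x s)" s] P(1)[of "norm (x s)"] xs by simp
    then have "(\<Psi> has_real_derivative L (norm (x s)) * (v \<bullet> sgn (x s)) - m) (at s)"
      unfolding \<Psi>_def by (auto intro!: derivative_eq_intros)
    moreover have "L (norm (x s)) * (v \<bullet> sgn (x s)) \<le> m"
    proof -
      have "v \<bullet> sgn (x s) \<le> norm v"
        using Cauchy_Schwarz_ineq2[of v "sgn (x s)"] xs by (simp add: norm_sgn)
      then have "L (norm (x s)) * (v \<bullet> sgn (x s)) \<le> norm (deriv F (x s)) * norm v"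
        using L(1)[OF xs(1)] L(2)[of "norm (x s)"] xs
        by (metis mult_left_mono mult_right_mono norm_ge_zero order_trans mem_ball_0)
      also have "\<dots> = m" using F'nz[OF xs(1)] by (simp add: v_def m_def norm_mult norm_divide)
      finally show ?thesis .
    qed
    ultimately show "\<exists>y. (\<Psi> has_real_derivative y) (at s) \<and> y \<le> 0" by fastforce
  qed simp
  then have "P r \<le> m" using z0 by (simp add: \<Psi>_def x0 x1 P(2))
  also have "\<dots> \<le> norm (F z)" using min[of z] by (simp add: m_def r_def)
  finally show ?thesis by (simp add: r_def)
qed

text \<open>
  Otherwise the inverse function would be a bounded entire function. The fact matters because the
  distance to an empty set is 0 by convention.
\<close>
lemma univalent_frontier_nonempty:
  assumes f: "f holomorphic_on unit_disc" "inj_on f unit_disc"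
  shows "frontier (f ` unit_disc) \<noteq> {}"
proof
  assume "frontier (f ` unit_disc) = {}"
  then have UN: "f ` unit_disc = UNIV" by (metis centre_in_ball empty_iff frontier_eq_empty image_is_empty zero_less_one)
  obtain j where j: "j holomorphic_on f ` unit_disc" "\<And>z. z \<in> unit_disc \<Longrightarrow> j (f z) = z"
    using holomorphic_has_inverse[OF f(1) open_ball f(2)] by metis
  have "j w \<in> unit_disc" for w using UN j(2) by (metis UNIV_I imageE)
  then have "bounded (range j)" by (intro bounded_subset[OF bounded_ball[of 0 1]]) auto
  then obtain c where "\<And>w. j w = c" using Liouville_theorem[of j] j(1) UN by (auto simp: constant_on_def)
  then show False using j(2)[of 0] j(2)[of "1/2"] by auto
qed

lemma ball_subset_univalent_image:
  assumes f: "f holomorphic_on unit_disc" "inj_on f unit_disc" "f 0 = 0"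
    and r: "0 < r" "r < 1" and m: "\<And>z. norm z = r \<Longrightarrow> m \<le> norm (f z)"
  shows "ball 0 m \<subseteq> f ` unit_disc"
proof (cases "0 < m")
  case True
  have "ball (f 0) m \<subseteq> f ` cball 0 r"
  proof (rule ball_subset_open_map_image)
    show "continuous_on (closure (cball 0 r)) f"
      using r by (intro holomorphic_on_imp_continuous_on holomorphic_on_subset[OF f(1)]) auto
    show "open (f ` interior (cball 0 r))"
      using r by (intro open_mapping_thm3 holomorphic_on_subset[OF f(1)] inj_on_subset[OF f(2)]) auto
    show "m \<le> norm (f x - f 0)" if "x \<in> frontier (cball 0 r)" for x
      using that m[of x] f(3) r by simp
  qed (use r True in auto)
  then show ?thesis using f(3) r by force
qed (simp add: ball_empty)

section \<open>The double integral of a majorant\<close>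

lemma power_series_has_real_derivative:
  fixes c :: "nat \<Rightarrow> real"
  assumes summ: "\<And>r. \<bar>r\<bar> < 1 \<Longrightarrow> summable (\<lambda>n. c n * r ^ n)" and x: "\<bar>x\<bar> < 1"
  shows "((\<lambda>r. \<Sum>n. c n * r ^ n) has_real_derivative (\<Sum>n. diffs c n * x ^ n)) (at x)"
    and "summable (\<lambda>n. diffs c n * x ^ n)"
proof -
  obtain K where K: "\<bar>x\<bar> < K" "K < 1" using x dense by blast
  show "((\<lambda>r. \<Sum>n. c n * r ^ n) has_real_derivative (\<Sum>n. diffs c n * x ^ n)) (at x)"
    by (rule termdiffs_strong[of c K]) (use summ K in auto)
  show "summable (\<lambda>n. diffs c n * x ^ n)"
    by (rule termdiff_converges[of x 1]) (use summ x in auto)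
qed

lemma continuous_on_majorant:
  assumes "f holomorphic_on unit_disc"
  shows "continuous_on {0..<1} (majorant f)"
proof -
  have "isCont (majorant f) x" if "\<bar>x\<bar> < 1" for x
    unfolding majorant_def[abs_def]
    by (rule DERIV_isCont, rule power_series_has_real_derivative(1))
      (use assms that in \<open>auto intro: summable_norm_taylor\<close>)
  then show ?thesis by (intro continuous_at_imp_continuous_on) auto
qed

definition iterated_mean :: "(real \<Rightarrow> real) \<Rightarrow> real \<Rightarrow> real" where
  "iterated_mean N r = integral {0..r} (\<lambda>s. 1 / s * integral {0..s} N)"

text \<open>
  The mean value of \<open>N\<close> over \<open>[0, s]\<close>, with the limit \<open>N 0\<close> at \<open>s = 0\<close> so that it is continuous.
\<close>
definition mean_from_0 :: "(real \<Rightarrow> real) \<Rightarrow> real \<Rightarrow> real" where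
  "mean_from_0 N s = (if s = 0 then N 0 else 1 / s * integral {0..s} N)"

lemma iterated_mean_eq: "iterated_mean N r = integral {0..r} (mean_from_0 N)"
  unfolding iterated_mean_def
  by (rule integral_spike[of "{0}"]) (auto simp: mean_from_0_def)

lemma continuous_on_mean_from_0:
  assumes N: "continuous_on {0..b} N"
  shows "continuous_on {0..b} (mean_from_0 N)"
proof (rule continuous_on_eq_continuous_within[THEN iffD2], rule ballI)
  fix x assume x: "x \<in> {0..b}"
  have der: "((\<lambda>s. integral {0..s} N) has_real_derivative N x) (at x within {0..b})"
    by (rule integral_has_real_derivative[OF N x])
  show "continuous (at x within {0..b}) (mean_from_0 N)"
  proof (cases "x = 0")
    case True
    have "((\<lambda>y. (integral {0..y} N - integral {0..x} N) / (y - x)) \<longlongrightarrow> N x) (at x within {0..b})"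
      using der by (simp add: has_field_derivative_iff)
    then have "(mean_from_0 N \<longlongrightarrow> N x) (at x within {0..b})"
      by (rule Lim_transform_eventually)
        (auto simp: eventually_at_filter True mean_from_0_def)
    then show ?thesis by (simp add: continuous_within True mean_from_0_def)
  next
    case False
    have "continuous (at x within {0..b}) (\<lambda>s. 1 / s * integral {0..s} N)"
      using False by (intro continuous_intros DERIV_continuous[OF der]) auto
    moreover have "\<forall>\<^sub>F y in at x within {0..b}. 1 / y * integral {0..y} N = mean_from_0 N y"
      using False x unfolding eventually_at
      by (intro exI[of _ x]) (auto simp: mean_from_0_def dist_real_def)
    ultimately show ?thesis using False
      unfolding continuous_within by (auto simp: mean_from_0_def elim: Lim_transform_eventually)
  qed
qed

lemma iterated_mean_mono:
  assumes N: "continuous_on {0..<1} N\<^sub>1" "continuous_on {0..<1} N\<^sub>2"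
    and le: "\<And>t. 0 \<le> t \<Longrightarrow> t \<le> r \<Longrightarrow> N\<^sub>1 t \<le> N\<^sub>2 t" and r: "r < 1"
  shows "iterated_mean N\<^sub>1 r \<le> iterated_mean N\<^sub>2 r"
  unfolding iterated_mean_eq
proof (rule integral_le)
  have N': "continuous_on {0..b} N\<^sub>1" "continuous_on {0..b} N\<^sub>2" if "b < 1" for b
    using that by (auto intro: continuous_on_subset N)
  show "mean_from_0 N\<^sub>1 integrable_on {0..r}" "mean_from_0 N\<^sub>2 integrable_on {0..r}"
    using N'[OF r] by (auto intro!: integrable_continuous_interval continuous_on_mean_from_0)
  fix s assume s: "s \<in> {0..r}"
  have "integral {0..s} N\<^sub>1 \<le> integral {0..s} N\<^sub>2"
    using N'[of s] s r le by (intro integral_le integrable_continuous_interval) auto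
  then show "mean_from_0 N\<^sub>1 s \<le> mean_from_0 N\<^sub>2 s"
    using s le[of 0] by (auto simp: mean_from_0_def divide_right_mono)
qed

lemma iterated_mean_nondecreasing:
  assumes N: "continuous_on {0..<1} N" and nn: "\<And>t. 0 \<le> t \<Longrightarrow> t < 1 \<Longrightarrow> 0 \<le> N t"
    and rs: "0 \<le> r" "r \<le> s" "s < 1"
  shows "iterated_mean N r \<le> iterated_mean N s"
  unfolding iterated_mean_eq
proof (rule integral_subset_le)
  have N': "continuous_on {0..b} N" if "b < 1" for b
    using that by (auto intro: continuous_on_subset N)
  show "mean_from_0 N integrable_on {0..r}" "mean_from_0 N integrable_on {0..s}"
    using N' rs by (auto intro!: integrable_continuous_interval continuous_on_mean_from_0)
  show "\<forall>t\<in>{0..s}. 0 \<le> mean_from_0 N t"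
  proof
    fix t assume t: "t \<in> {0..s}"
    have "0 \<le> integral {0..t} N"
      using N'[of t] t rs nn by (intro integral_nonneg integrable_continuous_interval) auto
    then show "0 \<le> mean_from_0 N t" using t nn[of 0] by (auto simp: mean_from_0_def)
  qed
qed (use rs in auto)

lemma continuous_on_iterated_mean:
  assumes N: "continuous_on {0..<1} N" and b: "b < 1"
  shows "continuous_on {0..b} (iterated_mean N)"
  unfolding iterated_mean_eq[abs_def]
  by (intro indefinite_integral_continuous_1 integrable_continuous_interval continuous_on_mean_from_0
      continuous_on_subset[OF N]) (use b in auto)

text \<open>
  Coefficientwise, \<open>(z f')'\<close> multiplies the coefficients of \<open>f\<close> by squares of integers, and each of the
  two integrations divides by one factor.
\<close>
lemma iterated_mean_majorant:
  assumes f: "f holomorphic_on unit_disc" "f 0 = 0" and r: "0 \<le> r" "r < 1"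
  shows "iterated_mean (majorant (deriv (\<lambda>w. w * deriv f w))) r = majorant f r"
proof -
  define a where "a n = norm (taylor f n)" for n
  \<comment> \<open>\<open>s\<close> times the derivative of the majorant, the value of the inner integral\<close>
  define B where "B s = (\<Sum>n. real n * a n * s ^ n)" for s :: real
  have "(\<lambda>w. w * deriv f w) has_fps_expansion fps_X * fps_deriv (fps_expansion f 0)"
    by (intro fps_expansion_intros has_fps_expansion_fps_expansion[of unit_disc] f) auto
  then have "deriv (\<lambda>w. w * deriv f w) has_fps_expansion fps_deriv (fps_X * fps_deriv (fps_expansion f 0))"
    by (rule has_fps_expansion_deriv)
  then have coeff: "norm (taylor (deriv (\<lambda>w. w * deriv f w)) n) = diffs (\<lambda>n. real n * a n) n" for n
    by (simp add: fps_expansion_eqI diffs_def a_def norm_mult del: of_nat_Suc fps_deriv_mult)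
  have summ_a: "summable (\<lambda>n. a n * s ^ n)" if "\<bar>s\<bar> < 1" for s
    unfolding a_def by (rule summable_norm_taylor[OF f(1) that])
  have summ_B: "summable (\<lambda>n. real n * a n * s ^ n)" if "\<bar>s\<bar> < 1" for s
  proof -
    have "summable (\<lambda>n. s * (diffs a n * s ^ n))"
      by (intro summable_mult power_series_has_real_derivative(2) summ_a that)
    then have "summable (\<lambda>n. real (Suc n) * a (Suc n) * s ^ Suc n)"
      by (simp add: diffs_def mult_ac)
    then show ?thesis using summable_Suc_iff[of "\<lambda>n. real n * a n * s ^ n"] by simp
  qed
  have B_eq: "B s = s * (\<Sum>n. diffs a n * s ^ n)" if "\<bar>s\<bar> < 1" for s
  proof -
    have "B s = (\<Sum>n. real (Suc n) * a (Suc n) * s ^ Suc n)"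
      unfolding B_def using suminf_split_head[OF summ_B[OF that]] by simp
    also have "\<dots> = (\<Sum>n. s * (diffs a n * s ^ n))" by (simp add: diffs_def mult_ac)
    also have "\<dots> = s * (\<Sum>n. diffs a n * s ^ n)"
      by (intro suminf_mult power_series_has_real_derivative(2) summ_a that)
    finally show ?thesis .
  qed
  have inner: "integral {0..s} (majorant (deriv (\<lambda>w. w * deriv f w))) = B s" if s: "0 \<le> s" "s < 1" for s
  proof -
    have "(majorant (deriv (\<lambda>w. w * deriv f w)) has_integral B s - B 0) {0..s}"
    proof (rule fundamental_theorem_of_calculus[OF s(1)])
      fix x assume x: "x \<in> {0..s}"
      have "(B has_real_derivative majorant (deriv (\<lambda>w. w * deriv f w)) x) (at x)"
        unfolding majorant_def coeff B_def
        by (rule power_series_has_real_derivative(1)) (use summ_B x s in auto)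
      then show "(B has_vector_derivative majorant (deriv (\<lambda>w. w * deriv f w)) x) (at x within {0..s})"
        by (simp add: has_real_derivative_iff_has_vector_derivative has_vector_derivative_at_within)
    qed
    moreover have "B 0 = 0" by (simp add: B_eq)
    ultimately show ?thesis by (simp add: integral_unique)
  qed
  have "((\<lambda>s. \<Sum>n. diffs a n * s ^ n) has_integral majorant f r - majorant f 0) {0..r}"
  proof (rule fundamental_theorem_of_calculus[OF r(1)])
    fix x assume x: "x \<in> {0..r}"
    have "(majorant f has_real_derivative (\<Sum>n. diffs a n * x ^ n)) (at x)"
      unfolding majorant_def[abs_def] a_def[symmetric]
      by (rule power_series_has_real_derivative(1)) (use summ_a x r in auto)
    then show "(majorant f has_vector_derivative (\<Sum>n. diffs a n * x ^ n)) (at x within {0..r})"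
      by (simp add: has_real_derivative_iff_has_vector_derivative has_vector_derivative_at_within)
  qed
  moreover have "majorant f 0 = 0"
    unfolding majorant_def using f(2) suminf_finite[of "{0}" "\<lambda>n. norm (taylor f n) * 0 ^ n"]
    by (auto simp: fps_expansion_def)
  ultimately have "integral {0..r} (\<lambda>s. \<Sum>n. diffs a n * s ^ n) = majorant f r"
    by (simp add: integral_unique)
  moreover have "iterated_mean (majorant (deriv (\<lambda>w. w * deriv f w))) r = integral {0..r} (\<lambda>s. \<Sum>n. diffs a n * s ^ n)"
    unfolding iterated_mean_def
    by (rule integral_spike[of "{0}"]) (use r in \<open>auto simp: inner B_eq\<close>)
  ultimately show ?thesis by simp
qed

text \<open>
  Here \<open>1 + z L''/L' = z g'/g\<close>, whose real part is positive by the supporting half-plane of \<open>g\<close> seen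
  from the origin: a convex function is starlike.
\<close>
section \<open>Primitives and reflection\<close>

lemma convex_function_primitive:
  assumes g: "convex_function g" "g 0 = 0"
    and L: "L holomorphic_on unit_disc" "\<And>z. z \<in> unit_disc \<Longrightarrow> z * deriv L z = g z"
  shows "convex_function L"
  unfolding convex_function_def
proof (intro conjI ballI)
  have g'nz: "deriv g z \<noteq> 0" if "z \<in> unit_disc" for z
    using g that by (auto simp: convex_function_def)
  have L': "deriv L holomorphic_on unit_disc" by (intro holomorphic_deriv L) auto
  have dg: "deriv g z = deriv L z + z * deriv (deriv L) z" if z: "z \<in> unit_disc" for z
  proof -
    have 1: "(deriv L has_field_derivative deriv (deriv L) z) (at z)"
      by (rule holomorphic_derivI[OF L' open_ball z])
    have "((\<lambda>z. z * deriv L z) has_field_derivative deriv L z + z * deriv (deriv L) z) (at z)"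
      by (rule derivative_eq_intros 1 refl)+ (simp add: algebra_simps)
    then have "(g has_field_derivative deriv L z + z * deriv (deriv L) z) (at z)"
      by (rule has_field_derivative_transform_within_open[OF _ open_ball z]) (use L(2) in auto)
    then show ?thesis by (rule DERIV_imp_deriv)
  qed
  show "L holomorphic_on unit_disc" by (rule L)
  fix z :: complex assume z: "z \<in> unit_disc"
  show nz: "deriv L z \<noteq> 0"
  proof (cases "z = 0")
    case True
    then show ?thesis using dg[of 0] g'nz[of 0] by simp
  next
    case False
    then have "g z \<noteq> g 0" using convex_function_inj_on[OF g(1)] z by (auto simp: inj_on_def)
    then show ?thesis using L(2)[OF z] g(2) by auto
  qed
  show "0 < Re (1 + z * deriv (deriv L) z / deriv L z)"
  proof (cases "z = 0")
    case False
    have eq: "1 + z * deriv (deriv L) z / deriv L z = z * deriv g z / g z"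
      unfolding L(2)[OF z, symmetric] dg[OF z] using nz False by (simp add: field_simps)
    have "Re (cnj (z * deriv g z) * (g 0 - g z)) < 0"
      by (rule convex_function_support[OF g(1)]) (use z False in auto)
    then have "0 < Re (cnj (z * deriv g z) * g z)" using g(2) by simp
    also have "\<dots> = Re (z * deriv g z * cnj (g z))" by (simp add: algebra_simps)
    finally have pos: "0 < Re (z * deriv g z * cnj (g z))" .
    then have "g z \<noteq> 0" by auto
    moreover have "z * deriv g z / g z = (z * deriv g z * cnj (g z)) / of_real ((norm (g z))\<^sup>2)"
      using \<open>g z \<noteq> 0\<close> by (simp add: complex_norm_square del: of_real_power)
    then have "Re (z * deriv g z / g z) = Re (z * deriv g z * cnj (g z)) / (norm (g z))\<^sup>2"
      by (simp only: Re_divide_of_real)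
    ultimately show ?thesis unfolding eq using pos by simp
  qed simp
qed

lemma exists_log_primitive:
  assumes \<psi>: "\<psi> holomorphic_on unit_disc" "\<psi> 0 = 1"
  obtains h where "h holomorphic_on unit_disc" "h 0 = 0"
    "\<And>z. z \<in> unit_disc \<Longrightarrow> z * deriv h z = \<psi> z - 1"
proof -
  have "(\<lambda>z. \<psi> z - 1) holomorphic_on unit_disc" by (intro holomorphic_intros \<psi>)
  then obtain q where q: "q holomorphic_on unit_disc" "\<And>z. norm z < 1 \<Longrightarrow> \<psi> z - 1 = z * q z"
    using Schwarz3[of "\<lambda>z. \<psi> z - 1" 1] \<psi>(2) by auto
  obtain h where h: "\<And>z. z \<in> unit_disc \<Longrightarrow> (h has_field_derivative q z) (at z within unit_disc)"
    using holomorphic_convex_primitive'[OF convex_ball open_ball q(1)] by blast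
  have h': "((\<lambda>z. h z - h 0) has_field_derivative q z) (at z)" if "z \<in> unit_disc" for z
    using h[OF that] that by (auto intro!: derivative_eq_intros simp: at_within_open[OF _ open_ball])
  show ?thesis
  proof (rule that[of "\<lambda>z. h z - h 0"])
    show "(\<lambda>z. h z - h 0) holomorphic_on unit_disc"
      unfolding holomorphic_on_open[OF open_ball] using h' by blast
    show "z * deriv (\<lambda>z. h z - h 0) z = \<psi> z - 1" if "z \<in> unit_disc" for z
      using DERIV_imp_deriv[OF h'[OF that]] q(2)[of z] that by simp
  qed simp
qed

lemma eq_of_deriv_eq_off_0:
  assumes f: "f holomorphic_on unit_disc" "g holomorphic_on unit_disc" "f 0 = g 0"
    and eq: "\<And>z. z \<in> unit_disc \<Longrightarrow> z \<noteq> 0 \<Longrightarrow> deriv f z = deriv g z"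
    and z: "z \<in> unit_disc"
  shows "f z = g z"
proof -
  have "\<exists>c. \<forall>z\<in>unit_disc. f z - g z = c"
  proof (rule DERIV_zero_connected_constant[of unit_disc "{0}" "\<lambda>z. f z - g z"])
    show "continuous_on unit_disc (\<lambda>z. f z - g z)"
      by (intro continuous_intros holomorphic_on_imp_continuous_on f)
    show "\<forall>x\<in>unit_disc - {0}. ((\<lambda>z. f z - g z) has_field_derivative 0) (at x)"
    proof
      fix x :: complex assume x: "x \<in> unit_disc - {0}"
      then have xD: "x \<in> unit_disc" by simp
      show "((\<lambda>z. f z - g z) has_field_derivative 0) (at x)"
        using DERIV_diff[OF holomorphic_derivI[OF f(1) open_ball xD] holomorphic_derivI[OF f(2) open_ball xD]]
          eq[of x] x by simp
    qed
  qed (auto simp: connected_ball)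
  then obtain c where "\<And>z. z \<in> unit_disc \<Longrightarrow> f z - g z = c" by auto
  from this[of z] this[of 0] z f(3) show ?thesis by simp
qed

text \<open>
  The derivative of \<open>u exp (- p)\<close> vanishes off the origin, and the value at the origin is 1.
\<close>
lemma eq_exp_of_log_derivative:
  assumes u: "u holomorphic_on unit_disc" "u 0 = 1" and p: "p holomorphic_on unit_disc" "p 0 = 0"
    and eq: "\<And>z. z \<in> unit_disc \<Longrightarrow> z * deriv u z = u z * (z * deriv p z)"
    and z: "z \<in> unit_disc"
  shows "u z = exp (p z)"
proof -
  have "u z * exp (- p z) = 1"
  proof (rule eq_of_deriv_eq_off_0[where g = "\<lambda>_. 1", OF _ _ _ _ z])
    show "(\<lambda>z. u z * exp (- p z)) holomorphic_on unit_disc" by (intro holomorphic_intros u p)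
    fix x :: complex assume x: "x \<in> unit_disc" "x \<noteq> 0"
    note 1 = holomorphic_derivI[OF u(1) open_ball x(1)]
    note 2 = holomorphic_derivI[OF p(1) open_ball x(1)]
    have "((\<lambda>z. u z * exp (- p z)) has_field_derivative 0) (at x)"
      by (rule derivative_eq_intros 1 2 refl)+ (use eq[OF x(1)] x(2) in simp)
    then show "deriv (\<lambda>z. u z * exp (- p z)) x = deriv (\<lambda>_. 1) x" by (simp add: DERIV_imp_deriv)
  qed (use u p in auto)
  then show ?thesis by (simp add: exp_minus field_simps)
qed

lemma holomorphic_cnj_cnj:
  assumes "f holomorphic_on unit_disc"
  shows "(\<lambda>z. cnj (f (cnj z))) holomorphic_on unit_disc"
    and "\<And>z. z \<in> unit_disc \<Longrightarrow> deriv (\<lambda>z. cnj (f (cnj z))) z = cnj (deriv f (cnj z))"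
proof -
  have der: "((\<lambda>z. cnj (f (cnj z))) has_field_derivative cnj (deriv f (cnj z))) (at z)"
    if "z \<in> unit_disc" for z
    using has_field_derivative_cnj_cnj[OF holomorphic_derivI[OF assms open_ball, of "cnj z"]] that
    by (simp add: o_def)
  then show "(\<lambda>z. cnj (f (cnj z))) holomorphic_on unit_disc"
    unfolding holomorphic_on_open[OF open_ball] by blast
  show "deriv (\<lambda>z. cnj (f (cnj z))) z = cnj (deriv f (cnj z))" if "z \<in> unit_disc" for z
    by (rule DERIV_imp_deriv[OF der[OF that]])
qed

section \<open>The extremal function of a Ma-Minda function\<close>

locale ma_minda_extremal =
  fixes \<phi> k :: "complex \<Rightarrow> complex"
  assumes ma_minda: "ma_minda \<phi>"
    and min_modulus: "\<And>r::real. 0 < r \<Longrightarrow> r < 1 \<Longrightarrow>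
           complex_of_real (INF z\<in>sphere 0 r. norm (\<phi> z)) = \<phi> (- complex_of_real r)"
    and k_hol: "k holomorphic_on unit_disc"
    and k_ode: "\<And>z. z \<in> unit_disc \<Longrightarrow> 1 + z * deriv (deriv k) z / deriv k z = \<phi> z"
    and k_0: "k 0 = 0" and k'_0: "deriv k 0 = 1"
begin

lemma \<phi>_hol: "\<phi> holomorphic_on unit_disc" and \<phi>_inj: "inj_on \<phi> unit_disc"
  and \<phi>_0: "\<phi> 0 = 1" and \<phi>_star: "starlike_wrt 1 (\<phi> ` unit_disc)"
  using ma_minda by (auto simp: ma_minda_def)

lemma Re_\<phi>_pos: "z \<in> unit_disc \<Longrightarrow> 0 < Re (\<phi> z)"
  using ma_minda unfolding ma_minda_def by blast

lemma \<phi>_neg: "0 \<le> r \<Longrightarrow> r < 1 \<Longrightarrow> \<phi> (- complex_of_real r) = of_real (Re (\<phi> (- complex_of_real r)))"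
  using min_modulus[of r] \<phi>_0 by (cases "r = 0") (auto simp flip: min_modulus)

text \<open>
  By the minimum modulus hypothesis \<open>\<phi>\<close> is real on the negative radius, which accumulates at the
  origin, so the identity theorem applies.
\<close>
lemma \<phi>_cnj: "z \<in> unit_disc \<Longrightarrow> cnj (\<phi> (cnj z)) = \<phi> z"
proof -
  assume z: "z \<in> unit_disc"
  have "cnj (\<phi> (cnj z)) - \<phi> z = 0"
  proof (rule analytic_continuation[of "\<lambda>z. cnj (\<phi> (cnj z)) - \<phi> z" unit_disc "(\<lambda>r. - of_real r) ` {0<..<1}" 0])
    show "(\<lambda>z. cnj (\<phi> (cnj z)) - \<phi> z) holomorphic_on unit_disc"
      by (intro holomorphic_intros holomorphic_cnj_cnj \<phi>_hol)
    show "0 islimpt (\<lambda>r. - of_real r :: complex) ` {0<..<1}"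
      unfolding islimpt_approachable
    proof (intro allI impI)
      fix e :: real assume "0 < e"
      then show "\<exists>x'\<in>(\<lambda>r. - of_real r :: complex) ` {0<..<1}. x' \<noteq> 0 \<and> dist x' 0 < e"
        by (intro bexI[of _ "- of_real (min (e / 2) (1 / 2))"] conjI) auto
    qed
    show "cnj (\<phi> (cnj w)) - \<phi> w = 0" if w: "w \<in> (\<lambda>r. - of_real r :: complex) ` {0<..<1}" for w
    proof -
      obtain r where r: "0 < r" "r < 1" "w = - of_real r" using w by auto
      then have "cnj (\<phi> w) = \<phi> w" using \<phi>_neg[of r] by (metis complex_cnj_complex_of_real less_imp_le)
      then show ?thesis using r by simp
    qed
  qed (use z in auto)
  then show ?thesis by simp
qed

text \<open>
  The maximum principle for \<open>1/\<phi>\<close> extends the hypothesis from the circle to the closed disc.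
\<close>
lemma \<phi>_min_modulus:
  assumes w: "norm w \<le> r" and r: "r < 1"
  shows "Re (\<phi> (- complex_of_real r)) \<le> norm (\<phi> w)"
proof (cases "0 < r")
  case False
  then have "norm w = 0" "r = 0" using w norm_ge_zero[of w] by linarith+
  then show ?thesis by (simp add: \<phi>_0)
next
  case True
  define m where "m = Re (\<phi> (- complex_of_real r))"
  have nz: "\<phi> z \<noteq> 0" if "z \<in> unit_disc" for z using Re_\<phi>_pos[OF that] by auto
  have m0: "0 < m" unfolding m_def using Re_\<phi>_pos True r by simp
  have m_eq: "m = (INF z\<in>sphere 0 r. norm (\<phi> z))"
    unfolding m_def using min_modulus[OF True r] by (metis Re_complex_of_real)
  have m_le: "m \<le> norm (\<phi> z)" if "norm z = r" for z
    unfolding m_eq by (rule cINF_lower) (use that in \<open>auto intro: bdd_belowI[of _ 0]\<close>)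
  have hol: "(\<lambda>z. inverse (\<phi> z)) holomorphic_on unit_disc"
    by (intro holomorphic_intros \<phi>_hol nz)
  have "norm (inverse (\<phi> w)) \<le> inverse m"
  proof (rule maximum_modulus_frontier[of "\<lambda>z. inverse (\<phi> z)" "cball 0 r"])
    show "(\<lambda>z. inverse (\<phi> z)) holomorphic_on interior (cball 0 r)"
      using r by (intro holomorphic_on_subset[OF hol]) auto
    show "continuous_on (closure (cball 0 r)) (\<lambda>z. inverse (\<phi> z))"
      using r by (intro holomorphic_on_imp_continuous_on holomorphic_on_subset[OF hol]) auto
    show "norm (inverse (\<phi> z)) \<le> inverse m" if "z \<in> frontier (cball 0 r)" for z
      using m_le[of z] that True m0 by (simp add: norm_inverse le_imp_inverse_le)
  qed (use w in auto)
  moreover have "0 < norm (\<phi> w)" using nz[of w] w r by simp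
  ultimately show ?thesis using m0 by (simp add: norm_inverse m_def[symmetric])
qed

lemma \<phi>_neg_less_1:
  assumes r: "0 < r" "r < 1"
  shows "Re (\<phi> (- complex_of_real r)) < 1"
proof -
  have "Re (\<phi> (- complex_of_real r)) \<le> 1"
    using \<phi>_min_modulus[of 0 r] r by (simp add: \<phi>_0)
  moreover have "Re (\<phi> (- complex_of_real r)) \<noteq> 1"
  proof
    assume "Re (\<phi> (- complex_of_real r)) = 1"
    then have "\<phi> (- complex_of_real r) = \<phi> 0" using \<phi>_neg[of r] r \<phi>_0 by simp
    then show False using inj_onD[OF \<phi>_inj, of "- complex_of_real r" 0] r by simp
  qed
  ultimately show ?thesis by simp
qed

text \<open>
  At a zero of \<open>k'\<close> the quotient in the differential equation is 0, so \<open>\<phi> = 1\<close> there, which by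
  univalence happens only at the origin.
\<close>
lemma k'_nz:
  assumes z: "z \<in> unit_disc"
  shows "deriv k z \<noteq> 0"
proof
  assume 0: "deriv k z = 0"
  then have "\<phi> z = \<phi> 0" using k_ode[OF z] \<phi>_0 by simp
  then have "z = 0" using inj_onD[OF \<phi>_inj, of z 0] z by simp
  then show False using 0 k'_0 by simp
qed

lemma k'_hol: "deriv k holomorphic_on unit_disc"
  by (intro holomorphic_deriv k_hol) auto

lemma zk'_deriv:
  assumes z: "z \<in> unit_disc"
  shows "deriv k z + z * deriv (deriv k) z = deriv k z * \<phi> z"
    and "deriv (\<lambda>w. w * deriv k w) z = deriv k z * \<phi> z"
proof -
  show 1: "deriv k z + z * deriv (deriv k) z = deriv k z * \<phi> z"
    using k_ode[OF z, symmetric] k'_nz[OF z] by (simp add: field_simps)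
  note d = holomorphic_derivI[OF k'_hol open_ball z]
  have "((\<lambda>w. w * deriv k w) has_field_derivative deriv k z * \<phi> z) (at z)"
    by (rule derivative_eq_intros d refl)+ (use 1 in \<open>simp add: algebra_simps\<close>)
  then show "deriv (\<lambda>w. w * deriv k w) z = deriv k z * \<phi> z" by (rule DERIV_imp_deriv)
qed

text \<open>
  The branch of \<open>log k'\<close> vanishing at the origin.
\<close>
definition H :: "complex \<Rightarrow> complex" where
  "H = (SOME h. h holomorphic_on unit_disc \<and> h 0 = 0 \<and> (\<forall>z\<in>unit_disc. z * deriv h z = \<phi> z - 1))"

lemma H_hol: "H holomorphic_on unit_disc" and H_0: "H 0 = 0"
  and zH': "\<And>z. z \<in> unit_disc \<Longrightarrow> z * deriv H z = \<phi> z - 1"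
proof -
  have "\<exists>h. h holomorphic_on unit_disc \<and> h 0 = 0 \<and> (\<forall>z\<in>unit_disc. z * deriv h z = \<phi> z - 1)"
    using exists_log_primitive[OF \<phi>_hol \<phi>_0] by metis
  then have "H holomorphic_on unit_disc \<and> H 0 = 0 \<and> (\<forall>z\<in>unit_disc. z * deriv H z = \<phi> z - 1)"
    unfolding H_def by (rule someI_ex)
  then show "H holomorphic_on unit_disc" "H 0 = 0"
    "\<And>z. z \<in> unit_disc \<Longrightarrow> z * deriv H z = \<phi> z - 1" by auto
qed

lemma k'_eq_exp_H: "z \<in> unit_disc \<Longrightarrow> deriv k z = exp (H z)"
proof (rule eq_exp_of_log_derivative[OF k'_hol k'_0 H_hol H_0])
  fix x :: complex assume x: "x \<in> unit_disc"
  show "x * deriv (deriv k) x = deriv k x * (x * deriv H x)"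
    unfolding zH'[OF x] using zk'_deriv(1)[OF x] by (simp add: algebra_simps)
qed

lemma zH'_inj: "inj_on (\<lambda>z. z * deriv H z) unit_disc"
  using \<phi>_inj by (auto simp: inj_on_def zH')

lemma zH'_star: "starlike_wrt 0 ((\<lambda>z. z * deriv H z) ` unit_disc)"
proof -
  have im: "(\<lambda>z. z * deriv H z) ` unit_disc = (\<lambda>w. -1 + w) ` \<phi> ` unit_disc"
    by (force simp: zH' image_image)
  have "closed_segment 0 (-1 + w) \<subseteq> (\<lambda>w. -1 + w) ` \<phi> ` unit_disc" if "w \<in> \<phi> ` unit_disc" for w
  proof -
    have "closed_segment 1 w \<subseteq> \<phi> ` unit_disc" using \<phi>_star that unfolding starlike_wrt_def by blast
    then have "(\<lambda>w. -1 + w) ` closed_segment 1 w \<subseteq> (\<lambda>w. -1 + w) ` \<phi> ` unit_disc" by (rule image_mono)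
    then show ?thesis using closed_segment_translation[of "-1" 1 w] by simp
  qed
  moreover have "0 \<in> (\<lambda>w. -1 + w) ` \<phi> ` unit_disc"
    using \<phi>_0 by (auto simp: image_iff intro!: bexI[of _ 0])
  ultimately show ?thesis unfolding im starlike_wrt_def by blast
qed

lemma H_convex: "convex_function H"
  by (rule convex_of_starlike[OF H_hol zH'_inj zH'_star])

lemma H_cnj: "z \<in> unit_disc \<Longrightarrow> cnj (H (cnj z)) = H z"
proof (rule eq_of_deriv_eq_off_0[OF holomorphic_cnj_cnj(1)[OF H_hol] H_hol])
  fix x :: complex assume x: "x \<in> unit_disc" "x \<noteq> 0"
  have "x * cnj (deriv H (cnj x)) = cnj (cnj x * deriv H (cnj x))" by simp
  also have "\<dots> = x * deriv H x" using zH'[of "cnj x"] zH'[OF x(1)] \<phi>_cnj[OF x(1)] x by simp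
  finally show "deriv (\<lambda>z. cnj (H (cnj z))) x = deriv H x"
    using x holomorphic_cnj_cnj(2)[OF H_hol x(1)] by simp
qed (simp_all add: H_0)

lemma k_cnj: "z \<in> unit_disc \<Longrightarrow> cnj (k (cnj z)) = k z"
proof (rule eq_of_deriv_eq_off_0[OF holomorphic_cnj_cnj(1)[OF k_hol] k_hol])
  fix x :: complex assume x: "x \<in> unit_disc"
  then show "deriv (\<lambda>z. cnj (k (cnj z))) x = deriv k x"
    using holomorphic_cnj_cnj(2)[OF k_hol x] k'_eq_exp_H[of "cnj x"] k'_eq_exp_H[OF x] H_cnj[OF x]
    by (simp add: exp_cnj)
qed (simp_all add: k_0)

text \<open>
  \<open>k'\<close> along the negative radius, where it is real and positive.
\<close>
definition \<kappa> :: "real \<Rightarrow> real" where "\<kappa> t = Re (deriv k (- of_real t))"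

lemma k'_neg: "0 \<le> t \<Longrightarrow> t < 1 \<Longrightarrow> deriv k (- of_real t) = of_real (\<kappa> t)"
  and \<kappa>_pos: "0 \<le> t \<Longrightarrow> t < 1 \<Longrightarrow> 0 < \<kappa> t"
proof -
  assume t: "0 \<le> t" "t < 1"
  have tD: "- of_real t \<in> unit_disc" using t by simp
  have "cnj (H (- of_real t)) = H (- of_real t)" using H_cnj[OF tD] by simp
  then have "H (- of_real t) = of_real (Re (H (- of_real t)))"
    by (simp add: complex_eq_iff)
  then have e: "deriv k (- of_real t) = of_real (exp (Re (H (- of_real t))))"
    using k'_eq_exp_H[OF tD] by (metis exp_of_real)
  then have "\<kappa> t = exp (Re (H (- of_real t)))" by (simp add: \<kappa>_def)
  with e show "deriv k (- of_real t) = of_real (\<kappa> t)" "0 < \<kappa> t" by simp_all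
qed

text \<open>
  The tangent line to \<open>H(|z| = r)\<close> at \<open>H(-r)\<close> is vertical, since \<open>z H' = \<phi> - 1\<close> is real and negative
  at \<open>-r\<close>; so the supporting half-plane says that \<open>Re H\<close> is smallest there.
\<close>
lemma \<kappa>_le_norm_k':
  assumes w: "norm w \<le> r" and r: "r < 1"
  shows "\<kappa> r \<le> norm (deriv k w)"
proof -
  define z where "z = - complex_of_real r"
  have r0: "0 \<le> r" using w norm_ge_zero[of w] by linarith
  have zD: "z \<in> unit_disc" and wD: "w \<in> unit_disc" using w r r0 by (auto simp: z_def)
  have "Re (H z) \<le> Re (H w)"
  proof (cases "w = z")
    case False
    have "0 < r" using False w r0 by (cases "r = 0") (auto simp: z_def)
    have "Re (cnj (z * deriv H z) * (H w - H z)) < 0"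
      by (rule convex_function_support[OF H_convex]) (use w r r0 False in \<open>auto simp: z_def\<close>)
    moreover have "z * deriv H z = of_real (Re (\<phi> z) - 1)"
      using zH'[OF zD] \<phi>_neg[OF r0 r] by (simp add: z_def)
    ultimately have "(Re (\<phi> z) - 1) * (Re (H w) - Re (H z)) < 0" by simp
    then show ?thesis using \<phi>_neg_less_1[OF \<open>0 < r\<close> r] by (simp add: z_def mult_less_0_iff)
  qed simp
  then have "norm (deriv k z) \<le> norm (deriv k w)"
    unfolding k'_eq_exp_H[OF zD] k'_eq_exp_H[OF wD] by simp
  then show ?thesis using k'_neg[OF r0 r] \<kappa>_pos[OF r0 r] by (simp add: z_def)
qed

text \<open>
  Here \<open>log g'\<close> is the mean of \<open>h\<close> and its reflection, where \<open>z h' = \<phi> \<circ> \<omega> - 1\<close>. Both lie in the convex,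
  symmetric set \<open>H(D)\<close>, hence so does their mean.
\<close>
section \<open>Functions convex with respect to conjugate points\<close>

lemma convex_and_subordinate:
  assumes g: "g holomorphic_on unit_disc" "deriv g 0 = 1"
    and \<omega>: "\<omega> holomorphic_on unit_disc" "\<omega> ` unit_disc \<subseteq> unit_disc" "\<omega> 0 = 0"
    and eq: "\<And>z. z \<in> unit_disc \<Longrightarrow> deriv g z + z * deriv (deriv g) z
        = deriv g z * ((\<phi> (\<omega> z) + cnj (\<phi> (\<omega> (cnj z)))) / 2)"
  shows "subordinate (deriv g) (deriv k)" and "convex_function g"
proof -
  have g': "deriv g holomorphic_on unit_disc" by (intro holomorphic_deriv g) auto
  have \<phi>\<omega>: "(\<lambda>z. \<phi> (\<omega> z)) holomorphic_on unit_disc"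
    by (rule holomorphic_on_compose_gen[OF \<omega>(1) \<phi>_hol \<omega>(2), unfolded o_def])
  obtain h where h: "h holomorphic_on unit_disc" "h 0 = 0"
      and zh': "\<And>z. z \<in> unit_disc \<Longrightarrow> z * deriv h z = \<phi> (\<omega> z) - 1"
    using exists_log_primitive[OF \<phi>\<omega>] \<omega>(3) \<phi>_0 by auto
  have \<omega>_in: "\<omega> z \<in> unit_disc" if "z \<in> unit_disc" for z using \<omega>(2) that by blast
  have h_in: "h z \<in> H ` unit_disc" if "z \<in> unit_disc" for z
    by (rule suffridge_image[OF H_convex H_0 zH'_inj zH'_star h \<omega> _ that]) (simp only: zh' zH' \<omega>_in)
  have ch_in: "cnj (h (cnj z)) \<in> H ` unit_disc" if z: "z \<in> unit_disc" for z
  proof -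
    obtain w where w: "w \<in> unit_disc" "h (cnj z) = H w" using h_in[of "cnj z"] z by auto
    then have "cnj (h (cnj z)) = H (cnj w)" using H_cnj[of "cnj w"] by simp
    then show ?thesis using w by auto
  qed
  define p where "p z = (h z + cnj (h (cnj z))) / 2" for z
  note ch = holomorphic_cnj_cnj[OF h(1)]
  have p: "p holomorphic_on unit_disc" "p 0 = 0"
    unfolding p_def by (auto intro!: holomorphic_intros h ch(1) simp: h(2))
  have zp': "z * deriv p z = (\<phi> (\<omega> z) + cnj (\<phi> (\<omega> (cnj z)))) / 2 - 1" if z: "z \<in> unit_disc" for z
  proof -
    note 1 = holomorphic_derivI[OF h(1) open_ball z] and 2 = holomorphic_derivI[OF ch(1) open_ball z]
    have "(p has_field_derivative (deriv h z + deriv (\<lambda>z. cnj (h (cnj z))) z) / 2) (at z)"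
      unfolding p_def using DERIV_cdivide[OF DERIV_add[OF 1 2], of 2] .
    then have "deriv p z = (deriv h z + cnj (deriv h (cnj z))) / 2"
      using ch(2)[OF z] by (simp add: DERIV_imp_deriv)
    then have "z * deriv p z = (z * deriv h z + cnj (cnj z * deriv h (cnj z))) / 2"
      by (simp add: algebra_simps)
    also have "\<dots> = ((\<phi> (\<omega> z) - 1) + cnj (\<phi> (\<omega> (cnj z)) - 1)) / 2"
      using zh'[OF z] zh'[of "cnj z"] z by (simp only: mem_ball_0 complex_mod_cnj)
    finally show ?thesis by (simp add: field_simps)
  qed
  have g'_exp: "deriv g z = exp (p z)" if "z \<in> unit_disc" for z
  proof (rule eq_exp_of_log_derivative[OF g' g(2) p _ that])
    fix x :: complex assume x: "x \<in> unit_disc"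
    show "x * deriv (deriv g) x = deriv g x * (x * deriv p x)"
      unfolding zp'[OF x] using eq[OF x] by (simp add: algebra_simps)
  qed
  have "p ` unit_disc \<subseteq> H ` unit_disc"
  proof (rule image_subsetI)
    fix z :: complex assume z: "z \<in> unit_disc"
    have "(1/2) *\<^sub>R h z + (1/2) *\<^sub>R cnj (h (cnj z)) \<in> H ` unit_disc"
      by (rule convexD[OF convex_function_image[OF H_convex] h_in[OF z] ch_in[OF z]]) auto
    then show "p z \<in> H ` unit_disc" by (simp add: p_def scaleR_conv_of_real field_simps)
  qed
  then have "subordinate p H"
    using p H_0 by (intro subordinate_of_image H_hol convex_function_inj_on H_convex) auto
  then obtain \<Omega> where \<Omega>: "\<Omega> holomorphic_on unit_disc" "\<Omega> ` unit_disc \<subseteq> unit_disc" "\<Omega> 0 = 0"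
      "\<And>z. z \<in> unit_disc \<Longrightarrow> p z = H (\<Omega> z)"
    by (auto simp: subordinate_def)
  have "deriv g z = deriv k (\<Omega> z)" if z: "z \<in> unit_disc" for z
  proof -
    have "\<Omega> z \<in> unit_disc" using \<Omega>(2) z by blast
    from k'_eq_exp_H[OF this] show ?thesis by (simp only: g'_exp[OF z] \<Omega>(4)[OF z])
  qed
  then show "subordinate (deriv g) (deriv k)" unfolding subordinate_def using \<Omega>(1-3) by blast
  show "convex_function g" unfolding convex_function_def
  proof (intro conjI ballI)
    fix z :: complex assume z: "z \<in> unit_disc"
    show nz: "deriv g z \<noteq> 0" using g'_exp[OF z] by simp
    have "1 + z * deriv (deriv g) z / deriv g z = (\<phi> (\<omega> z) + cnj (\<phi> (\<omega> (cnj z)))) / 2"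
      using eq[OF z] nz by (simp add: field_simps)
    also have "Re \<dots> > 0"
      using Re_\<phi>_pos[OF \<omega>_in[OF z]] Re_\<phi>_pos[OF \<omega>_in[of "cnj z"]] z by simp
    finally show "0 < Re (1 + z * deriv (deriv g) z / deriv g z)" .
  qed (rule g)
qed

text \<open>
  The function \<open>g\<close> is the mean of \<open>f\<close> and its reflection. As \<open>\<phi>\<close> has no zeros, the denominator of the
  defining quotient has none either, and the quotient can be cleared.
\<close>
lemma convex_conj_class_decomposition:
  assumes f: "f \<in> convex_conj_class \<phi>"
  obtains g \<omega> where "convex_function g" "g 0 = 0" "deriv g 0 = 1" "subordinate (deriv g) (deriv k)"
    "\<omega> holomorphic_on unit_disc" "\<omega> ` unit_disc \<subseteq> unit_disc" "\<omega> 0 = 0"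
    "\<And>z. z \<in> unit_disc \<Longrightarrow> deriv (\<lambda>w. w * deriv f w) z = deriv g z * \<phi> (\<omega> z)"
proof -
  have f_hol: "f holomorphic_on unit_disc" and f0: "f 0 = 0" and f'0: "deriv f 0 = 1"
    using f by (auto simp: convex_conj_class_def class_A_def)
  define F where "F = (\<lambda>w. w * deriv f w)"
  define S where "S = (\<lambda>w. f w + cnj (f (cnj w)))"
  obtain \<omega> where \<omega>: "\<omega> holomorphic_on unit_disc" "\<omega> ` unit_disc \<subseteq> unit_disc" "\<omega> 0 = 0"
      and quot: "\<And>z. z \<in> unit_disc \<Longrightarrow> 2 * deriv F z / deriv S z = \<phi> (\<omega> z)"
    using f by (auto simp: convex_conj_class_def subordinate_def F_def S_def)
  have \<omega>_in: "\<omega> z \<in> unit_disc" if "z \<in> unit_disc" for z using \<omega>(2) that by blast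
  have f': "deriv f holomorphic_on unit_disc" by (intro holomorphic_deriv f_hol) auto
  have F: "F holomorphic_on unit_disc" unfolding F_def by (intro holomorphic_intros f')
  note cf = holomorphic_cnj_cnj[OF f_hol] and cF = holomorphic_cnj_cnj[OF F]
  define g where "g z = S z / 2" for z
  have g: "g holomorphic_on unit_disc" unfolding g_def S_def by (intro holomorphic_intros f_hol cf) simp
  have dS: "(S has_field_derivative deriv f z + cnj (deriv f (cnj z))) (at z)" if z: "z \<in> unit_disc" for z
  proof -
    note 1 = holomorphic_derivI[OF f_hol open_ball z] and 2 = holomorphic_derivI[OF cf(1) open_ball z]
    show ?thesis unfolding S_def using DERIV_add[OF 1 2] cf(2)[OF z] by simp
  qed
  have g'_S: "deriv g z = deriv S z / 2" and g'_f: "deriv g z = (deriv f z + cnj (deriv f (cnj z))) / 2"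
    if "z \<in> unit_disc" for z
  proof -
    have "(g has_field_derivative (deriv f z + cnj (deriv f (cnj z))) / 2) (at z)"
      unfolding g_def using dS[OF that] by (auto intro!: derivative_eq_intros)
    then show "deriv g z = deriv S z / 2" "deriv g z = (deriv f z + cnj (deriv f (cnj z))) / 2"
      using dS[OF that] by (simp_all add: DERIV_imp_deriv)
  qed
  have F': "deriv F z = deriv g z * \<phi> (\<omega> z)" if z: "z \<in> unit_disc" for z
  proof -
    have "\<phi> (\<omega> z) \<noteq> 0" using Re_\<phi>_pos[OF \<omega>_in[OF z]] by auto
    then have "deriv S z \<noteq> 0" using quot[OF z] by auto
    then have "2 * deriv F z = deriv S z * \<phi> (\<omega> z)" using quot[OF z] by (simp add: divide_eq_eq mult.commute)
    moreover have "deriv S z = 2 * deriv g z" using g'_S[OF z] by (simp add: mult.commute)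
    ultimately show ?thesis by simp
  qed
  have "deriv g z + z * deriv (deriv g) z = deriv g z * ((\<phi> (\<omega> z) + cnj (\<phi> (\<omega> (cnj z)))) / 2)"
    if z: "z \<in> unit_disc" for z
  proof -
    have g': "deriv g holomorphic_on unit_disc" by (intro holomorphic_deriv g) auto
    note 1 = holomorphic_derivI[OF F open_ball z] and 2 = holomorphic_derivI[OF cF(1) open_ball z]
      and 3 = holomorphic_derivI[OF g' open_ball z]
    have zc: "cnj z \<in> unit_disc" using z by simp
    have "((\<lambda>z. (F z + cnj (F (cnj z))) / 2) has_field_derivative (deriv F z + cnj (deriv F (cnj z))) / 2) (at z)"
      using DERIV_cdivide[OF DERIV_add[OF 1 2], of 2] unfolding cF(2)[OF z] .
    then have "((\<lambda>w. w * deriv g w) has_field_derivative (deriv F z + cnj (deriv F (cnj z))) / 2) (at z)"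
      by (rule has_field_derivative_transform_within_open[OF _ open_ball z])
        (simp add: g'_f F_def algebra_simps)
    moreover have "((\<lambda>w. w * deriv g w) has_field_derivative deriv g z + z * deriv (deriv g) z) (at z)"
      by (rule derivative_eq_intros 3 refl)+ (simp add: algebra_simps)
    ultimately have "deriv g z + z * deriv (deriv g) z = (deriv F z + cnj (deriv F (cnj z))) / 2"
      by (rule DERIV_unique[symmetric])
    also have "\<dots> = (deriv g z * \<phi> (\<omega> z) + cnj (deriv g (cnj z)) * cnj (\<phi> (\<omega> (cnj z)))) / 2"
      unfolding F'[OF z] F'[OF zc] by simp
    also have "cnj (deriv g (cnj z)) = deriv g z"
      unfolding g'_f[OF z] g'_f[OF zc] by simp
    finally show ?thesis by (simp add: algebra_simps)
  qed
  moreover have "deriv g 0 = 1" using g'_f[of 0] f'0 by simp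
  moreover have "g 0 = 0" by (simp add: g_def S_def f0)
  ultimately show ?thesis
    using that[of g \<omega>] convex_and_subordinate[OF g _ \<omega>] \<omega> F' unfolding F_def by blast
qed

lemma \<kappa>_le_norm_of_subordinate:
  assumes g: "subordinate u (deriv k)" and z: "z \<in> unit_disc"
  shows "\<kappa> (norm z) \<le> norm (u z)"
proof -
  obtain \<Omega> where \<Omega>: "\<Omega> holomorphic_on unit_disc" "\<Omega> ` unit_disc \<subseteq> unit_disc" "\<Omega> 0 = 0"
      "u z = deriv k (\<Omega> z)"
    using g z by (auto simp: subordinate_def)
  have "norm (\<Omega> z) \<le> norm z"
    using Schwarz_Lemma(1)[OF \<Omega>(1,3)] \<Omega>(2) z by (auto simp: image_subset_iff)
  then show ?thesis using \<kappa>_le_norm_k'[of "\<Omega> z" "norm z"] z \<Omega>(4) by simp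
qed

lemma neg_path_has_vector_derivative:
  "((\<lambda>t. - complex_of_real t) has_vector_derivative -1) (at t)"
  by (auto intro!: derivative_eq_intros)

text \<open>
  The equation \<open>(z k')' = k' \<phi>\<close> on the negative radius.
\<close>
lemma t\<kappa>_has_real_derivative:
  assumes "0 \<le> t" "t < 1"
  shows "((\<lambda>t. t * \<kappa> t) has_real_derivative \<kappa> t * Re (\<phi> (- of_real t))) (at t)"
proof -
  define z where "z = - complex_of_real t"
  have z: "z \<in> unit_disc" using assms by (simp add: z_def)
  have 1: "(\<kappa> has_real_derivative - Re (deriv (deriv k) z)) (at t)"
    using has_real_derivative_Re_along_path[OF neg_path_has_vector_derivative,
        of "deriv k" "deriv (deriv k) z" t 1] holomorphic_derivI[OF k'_hol open_ball z]
    by (simp add: \<kappa>_def[abs_def] z_def)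
  have "Re (deriv k z + z * deriv (deriv k) z) = Re (deriv k z * \<phi> z)"
    using zk'_deriv(1)[OF z] by simp
  then have "\<kappa> t - t * Re (deriv (deriv k) z) = \<kappa> t * Re (\<phi> z)"
    using k'_neg[OF assms] by (simp add: z_def)
  then show ?thesis unfolding z_def[symmetric]
    by (auto intro!: derivative_eq_intros 1 simp: algebra_simps)
qed

lemma k_neg_has_real_derivative:
  assumes "0 \<le> t" "t < 1"
  shows "((\<lambda>t. - Re (k (- of_real t))) has_real_derivative \<kappa> t) (at t)"
  using has_real_derivative_Re_along_path[OF neg_path_has_vector_derivative,
      of k "deriv k (- of_real t)" t "-1"] holomorphic_derivI[OF k_hol open_ball, of "- of_real t"] assms
  by (simp add: \<kappa>_def)

text \<open>
  \<open>F = z f'\<close> is close-to-convex with respect to \<open>g\<close>, and \<open>f\<close> with respect to the primitive \<open>L\<close> of \<open>g/z\<close>: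
  \<open>f'/L' = F/g\<close> is a difference quotient of \<open>F\<close> against \<open>g\<close>. The growth lemma is then applied to \<open>F\<close>, which
  gives \<open>|f'(z)| \<ge> k'(-|z|)\<close>, and to \<open>f\<close>.
\<close>
lemma univalent_and_growth:
  assumes f: "f \<in> convex_conj_class \<phi>"
  shows "inj_on f unit_disc"
    and "z \<in> unit_disc \<Longrightarrow> - Re (k (- of_real (norm z))) \<le> norm (f z)"
proof -
  have f_hol: "f holomorphic_on unit_disc" and f0: "f 0 = 0" and f'0: "deriv f 0 = 1"
    using f by (auto simp: convex_conj_class_def class_A_def)
  obtain g \<omega> where g: "convex_function g" "g 0 = 0" "deriv g 0 = 1" "subordinate (deriv g) (deriv k)"
    and \<omega>: "\<omega> holomorphic_on unit_disc" "\<omega> ` unit_disc \<subseteq> unit_disc" "\<omega> 0 = 0"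
    and F': "\<And>z. z \<in> unit_disc \<Longrightarrow> deriv (\<lambda>w. w * deriv f w) z = deriv g z * \<phi> (\<omega> z)"
    by (rule convex_conj_class_decomposition[OF f]) (rule that, assumption+)
  have \<omega>_in: "\<omega> z \<in> unit_disc" if "z \<in> unit_disc" for z using \<omega>(2) that by blast
  define F where "F = (\<lambda>w. w * deriv f w)"
  have F: "F holomorphic_on unit_disc" unfolding F_def
    by (intro holomorphic_intros holomorphic_deriv f_hol) auto
  have g_hol: "g holomorphic_on unit_disc" and g'nz: "\<And>z. z \<in> unit_disc \<Longrightarrow> deriv g z \<noteq> 0"
    using g(1) by (auto simp: convex_function_def)
  have F_quot: "0 < Re ((F b - F a) / (g b - g a))"
    if "a \<in> unit_disc" "b \<in> unit_disc" "a \<noteq> b" for a b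
  proof (rule close_to_convex_difference_quotient[OF g(1) F _ that])
    fix z :: complex assume z: "z \<in> unit_disc"
    have "deriv F z / deriv g z = \<phi> (\<omega> z)" using F'[OF z] g'nz[OF z] by (simp add: F_def)
    then show "0 < Re (deriv F z / deriv g z)" using Re_\<phi>_pos[OF \<omega>_in[OF z]] by simp
  qed
  have F_inj: "inj_on F unit_disc"
  proof (rule inj_onI, rule ccontr)
    fix a b :: complex assume "a \<in> unit_disc" "b \<in> unit_disc" "F a = F b" "a \<noteq> b"
    then show False using F_quot[of a b] by simp
  qed
  \<comment> \<open>\<open>q = g/z\<close>, with the removable singularity filled in\<close>
  obtain q where q: "q holomorphic_on unit_disc" "\<And>z. norm z < 1 \<Longrightarrow> g z = z * q z" "deriv g 0 = q 0"
    using Schwarz3[OF g_hol g(2)] by blast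
  obtain L where L: "\<And>z. z \<in> unit_disc \<Longrightarrow> (L has_field_derivative q z) (at z)"
    using holomorphic_convex_primitive'[OF convex_ball open_ball q(1)]
    by (metis at_within_open open_ball)
  have L_hol: "L holomorphic_on unit_disc"
    unfolding holomorphic_on_open[OF open_ball] using L by blast
  have L': "deriv L z = q z" if "z \<in> unit_disc" for z using DERIV_imp_deriv[OF L[OF that]] .
  have L_convex: "convex_function L"
    by (rule convex_function_primitive[OF g(1,2) L_hol]) (simp add: L' q(2))
  have f_quot: "0 < Re ((f b - f a) / (L b - L a))"
    if "a \<in> unit_disc" "b \<in> unit_disc" "a \<noteq> b" for a b
  proof (rule close_to_convex_difference_quotient[OF L_convex f_hol _ that])
    fix z :: complex assume z: "z \<in> unit_disc"
    show "0 < Re (deriv f z / deriv L z)"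
    proof (cases "z = 0")
      case True
      then show ?thesis using f'0 g(3) q(3) L'[of 0] by simp
    next
      case False
      have "deriv f z / deriv L z = (F z - F 0) / (g z - g 0)"
        using False q(2)[of z] z L'[OF z] g(2) by (simp add: F_def)
      then show ?thesis using F_quot[of 0 z] z False by simp
    qed
  qed
  show f_inj: "inj_on f unit_disc"
  proof (rule inj_onI, rule ccontr)
    fix a b :: complex assume "a \<in> unit_disc" "b \<in> unit_disc" "f a = f b" "a \<noteq> b"
    then show False using f_quot[of a b] by simp
  qed
  have \<phi>_neg_pos: "0 < Re (\<phi> (- of_real t))" if "0 \<le> t" "t < 1" for t
    using Re_\<phi>_pos[of "- of_real t"] that by simp
  have F_growth: "norm z * \<kappa> (norm z) \<le> norm (F z)" if z: "z \<in> unit_disc" for z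
  proof (rule univalent_growth[where P = "\<lambda>t. t * \<kappa> t", OF F F_inj _ t\<kappa>_has_real_derivative _ _ _ z])
    fix x :: complex assume x: "x \<in> unit_disc"
    have "norm (\<omega> x) \<le> norm x"
      using Schwarz_Lemma(1)[OF \<omega>(1,3)] \<omega>(2) x by (auto simp: image_subset_iff)
    then have "Re (\<phi> (- of_real (norm x))) \<le> norm (\<phi> (\<omega> x))" using \<phi>_min_modulus x by simp
    then show "\<kappa> (norm x) * Re (\<phi> (- of_real (norm x))) \<le> norm (deriv F x)"
      using \<kappa>_le_norm_of_subordinate[OF g(4) x] \<phi>_neg_pos[of "norm x"] \<kappa>_pos[of "norm x"] x
      unfolding F_def F'[OF x] norm_mult by (intro mult_mono) auto
  next
    fix t :: real assume "0 \<le> t" "t < 1"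
    then show "0 \<le> \<kappa> t * Re (\<phi> (- of_real t))" using \<phi>_neg_pos \<kappa>_pos by (simp add: less_imp_le)
  qed (simp_all add: F_def)
  have f'_lower: "\<kappa> (norm z) \<le> norm (deriv f z)" if z: "z \<in> unit_disc" for z
  proof (cases "z = 0")
    case True
    then show ?thesis using f'0 k'_0 by (simp add: \<kappa>_def)
  next
    case False
    then show ?thesis using F_growth[OF z] by (simp add: F_def norm_mult)
  qed
  show "- Re (k (- of_real (norm z))) \<le> norm (f z)" if z: "z \<in> unit_disc"
    by (rule univalent_growth[where P = "\<lambda>t. - Re (k (- of_real t))",
          OF f_hol f_inj f0 k_neg_has_real_derivative _ f'_lower _ z])
      (use \<kappa>_pos k_0 in \<open>auto intro: less_imp_le\<close>)
qed

text \<open>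
  This is \<open>-k(-1)\<close>. A supremum is convenient because \<open>-k(-t)\<close> increases with \<open>t\<close>.
\<close>
section \<open>The covering radius\<close>

definition covering_radius :: real where
  "covering_radius = (SUP t\<in>{0..<1}. - Re (k (- of_real t)))"

lemma k_neg_mono:
  assumes "0 \<le> s" "s < t" "t < 1"
  shows "- Re (k (- of_real s)) < - Re (k (- of_real t))"
proof (rule DERIV_pos_imp_increasing[OF assms(2), of "\<lambda>t. - Re (k (- of_real t))"])
  fix x assume "s \<le> x" "x \<le> t"
  then have "0 \<le> x" "x < 1" using assms by auto
  then show "\<exists>y. ((\<lambda>t. - Re (k (- of_real t))) has_real_derivative y) (at x) \<and> 0 < y"
    using k_neg_has_real_derivative \<kappa>_pos by blast
qed

lemma k_neg_le_covering_radius: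
  assumes t: "0 \<le> t" "t < 1"
  shows "- Re (k (- of_real t)) \<le> covering_radius"
  unfolding covering_radius_def
proof (rule cSUP_upper)
  show "bdd_above ((\<lambda>t. - Re (k (- of_real t))) ` {0..<1})"
  proof (rule bdd_aboveI2)
    fix t :: real assume t: "t \<in> {0..<1}"
    have "- Re (k (- of_real t)) - t \<le> - Re (k (- of_real 0)) - 0"
    proof (rule DERIV_nonpos_imp_nonincreasing[of 0 t "\<lambda>t. - Re (k (- of_real t)) - t"])
      fix x assume x: "0 \<le> x" "x \<le> t"
      have "((\<lambda>t. - Re (k (- of_real t)) - t) has_real_derivative \<kappa> x - 1) (at x)"
        using x t by (intro DERIV_diff k_neg_has_real_derivative DERIV_ident) auto
      moreover have "\<kappa> x \<le> 1" using \<kappa>_le_norm_k'[of 0 x] x t k'_0 by simp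
      ultimately show "\<exists>y. ((\<lambda>t. - Re (k (- of_real t)) - t) has_real_derivative y) (at x) \<and> y \<le> 0"
        by (intro exI[of _ "\<kappa> x - 1"]) auto
    qed (use t in auto)
    then show "- Re (k (- of_real t)) \<le> 1" using t k_0 by simp
  qed
qed (use t in auto)

lemma k_neg_tendsto: "((\<lambda>t. - Re (k (- of_real t))) \<longlongrightarrow> covering_radius) (at_left (1::real))"
proof (rule order_tendstoI)
  fix a assume "a < covering_radius"
  then obtain s where s: "s \<in> {0..<1}" "a < - Re (k (- of_real s))"
    unfolding covering_radius_def using less_cSUP_iff[of "{0..<1::real}" "\<lambda>t. - Re (k (- of_real t))" a]
      bdd_aboveI2[of "{0..<1::real}" "\<lambda>t. - Re (k (- of_real t))" covering_radius] k_neg_le_covering_radius by auto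
  have "\<forall>\<^sub>F t in at_left 1. t \<in> {s<..<1}" using s by (intro eventually_at_left_real) auto
  then show "\<forall>\<^sub>F t in at_left 1. a < - Re (k (- of_real t))"
  proof eventually_elim
    case (elim t)
    then show ?case using s k_neg_mono[of s t] by simp
  qed
next
  fix a assume a: "covering_radius < a"
  have "\<forall>\<^sub>F t in at_left (1::real). t \<in> {0<..<1}" by (intro eventually_at_left_real) auto
  then show "\<forall>\<^sub>F t in at_left 1. - Re (k (- of_real t)) < a"
  proof eventually_elim
    case (elim t)
    then show ?case using a k_neg_le_covering_radius[of t] by simp
  qed
qed

lemma covering_radius_pos: "0 < covering_radius"
  using k_neg_mono[of 0 "1/2"] k_neg_le_covering_radius[of "1/2"] k_0 by simp

lemma value_at_minus_one_eq: "value_at_minus_one k = - of_real covering_radius"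
proof -
  have "((\<lambda>t. - complex_of_real (- Re (k (- of_real t)))) \<longlongrightarrow> - of_real covering_radius) (at_left (1::real))"
    by (intro tendsto_intros k_neg_tendsto)
  moreover have "\<forall>\<^sub>F t in at_left (1::real). t \<in> {0<..<1}" by (intro eventually_at_left_real) auto
  then have "\<forall>\<^sub>F t in at_left (1::real). - complex_of_real (- Re (k (- of_real t))) = k (- of_real t)"
  proof eventually_elim
    case (elim t)
    then have "cnj (k (- of_real t)) = k (- of_real t)" using k_cnj[of "- of_real t"] by simp
    then show ?case by (simp add: complex_eq_iff)
  qed
  ultimately have "((\<lambda>t. k (- of_real t)) \<longlongrightarrow> - of_real covering_radius) (at_left (1::real))"
    by (rule Lim_transform_eventually)
  then show ?thesis unfolding value_at_minus_one_def by (intro tendsto_Lim) auto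
qed

text \<open>
  By the growth estimate \<open>f(D)\<close> contains every disc about 0 of radius \<open>-k(-t)\<close>, and it is open, so
  its frontier stays outside.
\<close>
lemma covering_radius_le_infdist:
  assumes f: "f \<in> convex_conj_class \<phi>"
  shows "covering_radius \<le> infdist (f 0) (frontier (f ` unit_disc))"
proof -
  have f_hol: "f holomorphic_on unit_disc" and f0: "f 0 = 0"
    using f by (auto simp: convex_conj_class_def class_A_def)
  note f_inj = univalent_and_growth(1)[OF f]
  have "open (f ` unit_disc)" by (rule open_mapping_thm3[OF f_hol open_ball f_inj])
  have "covering_radius \<le> dist 0 w" if w: "w \<in> frontier (f ` unit_disc)" for w
    unfolding covering_radius_def
  proof (rule cSUP_least)
    fix t :: real assume t: "t \<in> {0..<1}"
    show "- Re (k (- of_real t)) \<le> dist 0 w"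
    proof (cases "t = 0")
      case False
      have "ball 0 (- Re (k (- of_real t))) \<subseteq> f ` unit_disc"
        by (rule ball_subset_univalent_image[OF f_hol f_inj f0, of t])
          (use t False univalent_and_growth(2)[OF f] in auto)
      moreover have "w \<notin> f ` unit_disc"
        using w \<open>open (f ` unit_disc)\<close> by (simp add: frontier_def interior_open)
      ultimately show ?thesis by (meson linorder_not_less mem_ball subsetD)
    qed (simp add: k_0)
  qed auto
  then show ?thesis
    using univalent_frontier_nonempty[OF f_hol f_inj] f0
    by (auto simp: infdist_def intro!: cINF_greatest)
qed

section \<open>Comparison of the majorant with the double integral\<close>

definition majorant_product :: "real \<Rightarrow> real" where
  "majorant_product t = majorant (deriv k) t * majorant \<phi> t"

lemma T_fun_eq: "T_fun k \<phi> = iterated_mean majorant_product"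
  by (simp add: T_fun_def[abs_def] iterated_mean_def[abs_def] majorant_product_def[abs_def])

lemma continuous_on_majorant_product: "continuous_on {0..<1} majorant_product"
  unfolding majorant_product_def[abs_def]
  by (intro continuous_intros continuous_on_majorant k'_hol \<phi>_hol)

lemma majorant_product_nonneg: "0 \<le> t \<Longrightarrow> t < 1 \<Longrightarrow> 0 \<le> majorant_product t"
  unfolding majorant_product_def by (intro mult_nonneg_nonneg majorant_nonneg k'_hol \<phi>_hol)

lemma majorant_cong:
  assumes "\<And>z. z \<in> unit_disc \<Longrightarrow> f z = g z"
  shows "majorant f = majorant g"
proof -
  have "\<forall>\<^sub>F z in nhds 0. f z = g z"
    by (rule eventually_mono[OF eventually_nhds_in_open[of unit_disc]]) (use assms in auto)
  then show ?thesis by (simp add: majorant_def[abs_def] fps_expansion_cong)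
qed

lemma majorant_le_T:
  assumes f: "f holomorphic_on unit_disc" "f 0 = 0" and r: "0 \<le> r" "r < 1"
    and le: "\<And>t. 0 \<le> t \<Longrightarrow> t \<le> r \<Longrightarrow> majorant (deriv (\<lambda>w. w * deriv f w)) t \<le> majorant_product t"
  shows "majorant f r \<le> T_fun k \<phi> r"
proof -
  have "(\<lambda>w. w * deriv f w) holomorphic_on unit_disc"
    by (intro holomorphic_intros holomorphic_deriv f) auto
  then have "deriv (\<lambda>w. w * deriv f w) holomorphic_on unit_disc"
    by (intro holomorphic_deriv) auto
  then show ?thesis
    unfolding T_fun_eq iterated_mean_majorant[OF f r, symmetric]
    by (intro iterated_mean_mono continuous_on_majorant continuous_on_majorant_product le r)
qed

text \<open>
  Both factors of \<open>(z f')' = g' (\<phi> \<circ> \<omega>)\<close> are subordinate to the corresponding factors of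
  \<open>(z k')' = k' \<phi>\<close>, so Bohr's phenomenon applies to each of them.
\<close>
lemma majorant_f_le_T:
  assumes f: "f \<in> convex_conj_class \<phi>" and r: "0 \<le> r" "r \<le> 1 / 3"
  shows "majorant f r \<le> T_fun k \<phi> r"
proof (rule majorant_le_T)
  show "f holomorphic_on unit_disc" "f 0 = 0"
    using f by (auto simp: convex_conj_class_def class_A_def)
  fix t assume "0 \<le> t" "t \<le> r"
  then have t: "0 \<le> t" "t \<le> 1 / 3" using r by auto
  obtain g \<omega> where g: "convex_function g" "g 0 = 0" "deriv g 0 = 1" "subordinate (deriv g) (deriv k)"
    and \<omega>: "\<omega> holomorphic_on unit_disc" "\<omega> ` unit_disc \<subseteq> unit_disc" "\<omega> 0 = 0"
    and F': "\<And>z. z \<in> unit_disc \<Longrightarrow> deriv (\<lambda>w. w * deriv f w) z = deriv g z * \<phi> (\<omega> z)"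
    by (rule convex_conj_class_decomposition[OF f]) (rule that, assumption+)
  have g': "deriv g holomorphic_on unit_disc"
    using g(1) by (intro holomorphic_deriv) (auto simp: convex_function_def)
  have \<phi>\<omega>: "(\<lambda>z. \<phi> (\<omega> z)) holomorphic_on unit_disc"
    by (rule holomorphic_on_compose_gen[OF \<omega>(1) \<phi>_hol \<omega>(2), unfolded o_def])
  have "majorant (deriv (\<lambda>w. w * deriv f w)) t = majorant (\<lambda>z. deriv g z * \<phi> (\<omega> z)) t"
    using majorant_cong[OF F'] by simp
  also have "\<dots> \<le> majorant (deriv g) t * majorant (\<lambda>z. \<phi> (\<omega> z)) t"
    using t by (intro majorant_mult_le g' \<phi>\<omega>) auto
  also have "\<dots> \<le> majorant (deriv k) t * majorant \<phi> t"
  proof (intro mult_mono majorant_subordinate_le g' k'_hol g(4) \<phi>\<omega> \<phi>_hol t majorant_nonneg)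
    show "subordinate (\<lambda>z. \<phi> (\<omega> z)) \<phi>" using \<omega> by (auto simp: subordinate_def)
  qed (use t in auto)
  finally show "majorant (deriv (\<lambda>w. w * deriv f w)) t \<le> majorant_product t"
    by (simp add: majorant_product_def)
qed (use r in auto)

text \<open>
  \<open>T\<close> dominates the majorant of \<open>k\<close>, and this exceeds \<open>-k(-r)\<close> already through the term of degree 2:
  it enters \<open>-k(-r)\<close> with the opposite sign, its coefficient being \<open>\<phi>'(0)/2 > 0\<close>. The gap is what
  pushes \<open>T\<close> strictly above \<open>-k(-1)\<close> before \<open>r = 1\<close>.
\<close>
lemma T_lower_bound:
  assumes r: "0 \<le> r" "r < 1"
  shows "- Re (k (- of_real r)) + Re (deriv \<phi> 0) * r\<^sup>2 \<le> T_fun k \<phi> r"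
proof -
  define K where "K = fps_expansion k 0"
  define b where "b = Re (deriv \<phi> 0)"
  have b: "deriv \<phi> 0 = of_real b" "0 < b"
    using ma_minda by (auto simp: ma_minda_def b_def)
  have kexp: "k has_fps_expansion K" and \<phi>exp: "\<phi> has_fps_expansion fps_expansion \<phi> 0"
    unfolding K_def by (auto intro!: has_fps_expansion_fps_expansion[of unit_disc] k_hol \<phi>_hol)
  have "(\<lambda>w. w * deriv k w) has_fps_expansion fps_X * fps_deriv K"
    by (intro fps_expansion_intros kexp)
  then have 1: "deriv (\<lambda>w. w * deriv k w) has_fps_expansion fps_deriv (fps_X * fps_deriv K)"
    by (rule has_fps_expansion_deriv)
  have "(\<lambda>w. deriv k w * \<phi> w) has_fps_expansion fps_deriv K * fps_expansion \<phi> 0"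
    by (intro fps_expansion_intros kexp \<phi>exp)
  moreover have ev: "\<forall>\<^sub>F w in nhds 0. deriv k w * \<phi> w = deriv (\<lambda>w. w * deriv k w) w"
    by (rule eventually_mono[OF eventually_nhds_in_open[of unit_disc]]) (auto simp: zk'_deriv(2))
  ultimately have "deriv (\<lambda>w. w * deriv k w) has_fps_expansion fps_deriv K * fps_expansion \<phi> 0"
    using has_fps_expansion_cong[OF ev refl] by blast
  \<comment> \<open>the coefficient of \<open>z\<close> in \<open>(z k')' = k' \<phi>\<close> determines the second coefficient of \<open>k\<close>\<close>
  from fps_expansion_unique_complex[OF 1 this]
  have "fps_nth (fps_deriv (fps_X * fps_deriv K)) 1 = fps_nth (fps_deriv K * fps_expansion \<phi> 0) 1"
    by simp
  moreover have "fps_nth K 1 = 1" "taylor \<phi> 0 = 1" "taylor \<phi> 1 = of_real b"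
    using k'_0 \<phi>_0 b by (simp_all add: K_def fps_expansion_def)
  ultimately have K2: "2 * fps_nth K 2 = of_real b"
    by (simp add: fps_mult_nth_1 numeral_2_eq_2 del: fps_deriv_mult)
  \<comment> \<open>the terms of the majorant at \<open>r\<close> minus \<open>-k(-r)\<close>: all are nonnegative, and the term of degree 2 is the gap\<close>
  define d where "d n = norm (fps_nth K n) * r ^ n + Re (fps_nth K n * (- of_real r) ^ n)" for n
  have "(\<lambda>n. fps_nth K n * (- of_real r) ^ n) sums k (- of_real r)"
    unfolding K_def by (rule taylor_sums[OF k_hol]) (use r in simp)
  then have "(\<lambda>n. Re (fps_nth K n * (- of_real r) ^ n)) sums Re (k (- of_real r))"
    by (rule sums_Re)
  moreover have "(\<lambda>n. norm (fps_nth K n) * r ^ n) sums majorant k r"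
    unfolding majorant_def K_def
    by (intro summable_sums summable_norm_taylor k_hol) (use r in auto)
  ultimately have d_sums: "d sums (majorant k r + Re (k (- of_real r)))"
    unfolding d_def by (intro sums_add)
  have d_nonneg: "0 \<le> d n" for n
  proof -
    have "norm (fps_nth K n * (- of_real r) ^ n) = norm (fps_nth K n) * r ^ n"
      using r by (simp add: norm_mult norm_power)
    then show ?thesis using abs_Re_le_cmod[of "fps_nth K n * (- of_real r) ^ n"] by (simp add: d_def)
  qed
  have "fps_nth K 2 = (2 * fps_nth K 2) / 2" by simp
  also have "\<dots> = of_real (b / 2)" unfolding K2 by simp
  finally have K2': "fps_nth K 2 = of_real (b / 2)" .
  have "b * r\<^sup>2 = norm (fps_nth K 2) * r\<^sup>2 + Re (fps_nth K 2) * r\<^sup>2"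
    unfolding K2' using b by simp
  also have "\<dots> = d 2" by (simp add: d_def flip: of_real_power)
  also have "\<dots> = (\<Sum>n\<in>{2}. d n)" by simp
  also have "\<dots> \<le> majorant k r + Re (k (- of_real r))"
    using sum_le_suminf[of d "{2}"] d_sums d_nonneg by (auto simp: sums_iff)
  finally have "- Re (k (- of_real r)) + b * r\<^sup>2 \<le> majorant k r" by simp
  also have "\<dots> \<le> T_fun k \<phi> r"
  proof (rule majorant_le_T[OF k_hol k_0 r])
    fix t assume t: "0 \<le> t" "t \<le> r"
    have "majorant (deriv (\<lambda>w. w * deriv k w)) = majorant (\<lambda>z. deriv k z * \<phi> z)"
      by (rule majorant_cong) (rule zk'_deriv(2))
    then show "majorant (deriv (\<lambda>w. w * deriv k w)) t \<le> majorant_product t"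
      using majorant_mult_le[OF k'_hol \<phi>_hol, of t] t r by (simp add: majorant_product_def)
  qed
  finally show ?thesis by (simp add: b_def)
qed

lemma smallest_root_T_exists: "\<exists>r. smallest_root_T k \<phi> r"
proof -
  define b where "b = Re (deriv \<phi> 0)"
  have b: "0 < b" using ma_minda by (auto simp: ma_minda_def b_def)
  \<comment> \<open>for \<open>r > 1/2\<close> the gap \<open>b r\<^sup>2\<close> is at least \<open>b/4\<close>, so a deficit below \<open>b/8\<close> is overcome\<close>
  have "\<forall>\<^sub>F t in at_left (1::real). covering_radius - b / 8 < - Re (k (- of_real t))"
    by (rule order_tendstoD(1)[OF k_neg_tendsto]) (use b in simp)
  moreover have "\<forall>\<^sub>F t in at_left (1::real). t \<in> {1/2<..<1}" by (intro eventually_at_left_real) auto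
  ultimately have "\<forall>\<^sub>F t in at_left (1::real). covering_radius - b / 8 < - Re (k (- of_real t)) \<and> t \<in> {1/2<..<1}"
    by eventually_elim auto
  then obtain r\<^sub>1 where r1: "covering_radius - b / 8 < - Re (k (- of_real r\<^sub>1))" "1 / 2 < r\<^sub>1" "r\<^sub>1 < 1"
    using eventually_happens'[of "at_left (1::real)"] by auto
  have "b * (1/4) \<le> b * r\<^sub>1\<^sup>2"
    using b r1 power_mono[of "1/2" r\<^sub>1 2] by (intro mult_left_mono) (auto simp: power2_eq_square)
  then have T_r1: "covering_radius < T_fun k \<phi> r\<^sub>1"
    using T_lower_bound[of r\<^sub>1] r1 b unfolding b_def[symmetric] by linarith
  have T_cont: "continuous_on {0..r\<^sub>1} (T_fun k \<phi>)"
    unfolding T_fun_eq by (rule continuous_on_iterated_mean[OF continuous_on_majorant_product r1(3)])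
  have T_0: "T_fun k \<phi> 0 = 0" by (simp add: T_fun_def)
  define S where "S = {r \<in> {0..r\<^sub>1}. T_fun k \<phi> r \<in> {covering_radius}}"
  have "compact S"
  proof -
    have "closed S" unfolding S_def
      using continuous_closed_preimage[OF T_cont, of "{covering_radius}"] by (simp add: vimage_def Int_def)
    moreover have "bounded S"
      by (rule bounded_subset[OF bounded_closed_interval[of 0 r\<^sub>1]]) (auto simp: S_def)
    ultimately show ?thesis by (simp add: compact_eq_bounded_closed)
  qed
  moreover have "S \<noteq> {}"
    using IVT'[of "T_fun k \<phi>" 0 covering_radius r\<^sub>1] T_0 T_r1 covering_radius_pos T_cont r1 by (force simp: S_def)
  ultimately obtain r where r: "r \<in> S" "\<And>s. s \<in> S \<Longrightarrow> r \<le> s"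
    using compact_attains_inf by metis
  have "r \<noteq> 0" using r(1) T_0 covering_radius_pos by (auto simp: S_def)
  then have "0 < r" "r < 1" "T_fun k \<phi> r = covering_radius" using r(1) r1 by (auto simp: S_def)
  moreover have "T_fun k \<phi> s \<noteq> covering_radius" if "0 < s" "s < r" for s
    using r(1) r(2)[of s] that by (auto simp: S_def)
  ultimately show ?thesis
    unfolding smallest_root_T_def value_at_minus_one_eq minus_minus of_real_eq_iff by blast
qed

lemma majorant_le_infdist:
  assumes f: "f \<in> convex_conj_class \<phi>" and root: "smallest_root_T k \<phi> r\<^sub>f"
    and r: "0 \<le> r" "r \<le> 1 / 3" "r \<le> r\<^sub>f"
  shows "majorant f r \<le> infdist (f 0) (frontier (f ` unit_disc))"
proof -
  have rf: "r\<^sub>f < 1" "T_fun k \<phi> r\<^sub>f = covering_radius"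
    using root unfolding smallest_root_T_def value_at_minus_one_eq minus_minus of_real_eq_iff by auto
  have "majorant f r \<le> T_fun k \<phi> r" by (rule majorant_f_le_T[OF f r(1,2)])
  also have "\<dots> \<le> T_fun k \<phi> r\<^sub>f"
    unfolding T_fun_eq
    by (rule iterated_mean_nondecreasing[OF continuous_on_majorant_product majorant_product_nonneg])
      (use r rf in auto)
  also have "\<dots> \<le> infdist (f 0) (frontier (f ` unit_disc))"
    using rf(2) covering_radius_le_infdist[OF f] by simp
  finally show ?thesis .
qed

end

lemma class_A_majorant:
  assumes f: "f \<in> class_A" and r: "0 \<le> r" "r < 1"
  shows "majorant f r = r + (\<Sum>n. norm (taylor f (n + 2)) * r ^ (n + 2))"
proof -
  have hol: "f holomorphic_on unit_disc" and t: "taylor f 0 = 0" "taylor f 1 = 1"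
    using f by (auto simp: class_A_def fps_expansion_def)
  have "summable (\<lambda>n. norm (taylor f n) * r ^ n)" using r by (intro summable_norm_taylor hol) auto
  from suminf_split_initial_segment[OF this, of 2] show ?thesis
    using t by (simp add: majorant_def numeral_2_eq_2)
qed

theorem theorem2p23:
  fixes \<phi> k f :: "complex \<Rightarrow> complex"
  assumes "ma_minda \<phi>"
    and "\<And>r::real. 0 < r \<Longrightarrow> r < 1 \<Longrightarrow>
           complex_of_real (INF z\<in>sphere 0 r. norm (\<phi> z)) = \<phi> (- complex_of_real r)"
    and "\<And>r::real. 0 < r \<Longrightarrow> r < 1 \<Longrightarrow>
           complex_of_real (SUP z\<in>sphere 0 r. norm (\<phi> z)) = \<phi> (complex_of_real r)"
    and "k holomorphic_on unit_disc"
    and "\<And>z. z \<in> unit_disc \<Longrightarrow> 1 + z * deriv (deriv k) z / deriv k z = \<phi> z"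
    and "k 0 = 0" and "deriv k 0 = 1"
    and "f \<in> convex_conj_class \<phi>"
  shows "\<exists>r\<^sub>f. smallest_root_T k \<phi> r\<^sub>f \<and>
           (\<forall>z::complex. norm z \<le> min (1 / 3) r\<^sub>f \<longrightarrow>
              norm z + (\<Sum>n. norm (fps_nth (fps_expansion f 0) (n + 2)) * norm z ^ (n + 2))
                \<le> infdist (f 0) (frontier (f ` unit_disc)))"
proof -
  interpret ma_minda_extremal \<phi> k by unfold_locales (fact assms)+
  obtain r\<^sub>f where root: "smallest_root_T k \<phi> r\<^sub>f" using smallest_root_T_exists by blast
  have A: "f \<in> class_A" using assms(8) by (simp add: convex_conj_class_def)
  show ?thesis
  proof (intro exI[of _ r\<^sub>f] conjI root allI impI)
    fix z :: complex assume z: "norm z \<le> min (1 / 3) r\<^sub>f"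
    have "norm z + (\<Sum>n. norm (taylor f (n + 2)) * norm z ^ (n + 2)) = majorant f (norm z)"
      using z by (intro class_A_majorant[OF A, symmetric]) auto
    also have "\<dots> \<le> infdist (f 0) (frontier (f ` unit_disc))"
      using z by (intro majorant_le_infdist[OF assms(8) root]) auto
    finally show "norm z + (\<Sum>n. norm (taylor f (n + 2)) * norm z ^ (n + 2))
                \<le> infdist (f 0) (frontier (f ` unit_disc))" .
  qed
qed

end
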